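(* Let $p$ be a prime and $\overline{\mathbb{F}}_p$ an algebraic closure of $\mathbb{F}_p$. Let $A>B>0$ be integers such that none of $A,\ B,\ A-B$ is divisible by $p$, and suppose $A\neq 2B$. Put $d=\gcd(A,B)$. Then the polynomial $$T_{A,B}(X,Y,Z)=\frac{R_{A,B}(X,Y,Z)}{V(X^d,Y^d,Z^d)}$$ is irreducible in $\overline{\mathbb{F}}_p[X,Y,Z]$.
   Context: $R_{A,B}(X,Y,Z)=\det\begin{pmatrix} X^{A} & Y^{A} & Z^{A}\\ X^{B} & Y^{B} & Z^{B}\\ 1&1&1\end{pmatrix}$ is the generalized Vandermonde determinant, and $V(X,Y,Z)=(X-Y)(Z-X)(Z-Y)$ is the Vandermonde determinant. With $d=\gcd(A,B)$, $R_{A,B}(X,Y,Z)$ is divisible by $V(X^d,Y^d,Z^d)$ in the polynomial ring, so $T_{A,B}$ is a polynomial. *)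

theory Defs
  imports
    "HOL-Analysis.Analysis"
    "HOL-Computational_Algebra.Computational_Algebra"
begin

text \<open>
  In a field of positive characteristic, \<open>\<int>\<close> (the range of \<^const>\<open>of_int\<close>) is the prime
  subfield; compare \<^const>\<open>algebraic\<close>, which the library restricts to characteristic 0.
\<close>
definition algebraic_over_prime_field :: "'k::field \<Rightarrow> bool" where
  "algebraic_over_prime_field x \<longleftrightarrow>
     (\<exists>q. q \<noteq> 0 \<and> (\<forall>i. coeff q i \<in> \<int>) \<and> poly q x = 0)"

definition is_algebraic_closure_of_F :: "nat \<Rightarrow> 'k::alg_closed_field itself \<Rightarrow> bool" where
  "is_algebraic_closure_of_F p _ \<longleftrightarrow>
     CHAR('k) = p \<and> (\<forall>x::'k. algebraic_over_prime_field x)"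

definition gen_vandermonde :: "nat \<Rightarrow> nat \<Rightarrow> 'r \<Rightarrow> 'r \<Rightarrow> 'r \<Rightarrow> 'r::comm_ring_1" where
  "gen_vandermonde A B x y z =
     det (vector [vector [x ^ A, y ^ A, z ^ A],
                  vector [x ^ B, y ^ B, z ^ B],
                  vector [1, 1, 1]] :: 'r ^ 3 ^ 3)"

definition vandermonde :: "'r \<Rightarrow> 'r \<Rightarrow> 'r \<Rightarrow> 'r::comm_ring_1" where
  "vandermonde x y z = (x - y) * (z - x) * (z - y)"

text \<open>The polynomial ring \<open>k[X,Y,Z]\<close> is the iterated ring \<open>k[X][Y][Z]\<close>.\<close>

definition varX :: "'k::comm_ring_1 poly poly poly" where "varX = [:[:[:0, 1:]:]:]"
definition varY :: "'k::comm_ring_1 poly poly poly" where "varY = [:[:0, 1:]:]"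
definition varZ :: "'k::comm_ring_1 poly poly poly" where "varZ = [:0, 1:]"

definition T_poly :: "nat \<Rightarrow> nat \<Rightarrow> 'k::field poly poly poly" where
  "T_poly A B =
     (let d = gcd A B
      in gen_vandermonde A B varX varY varZ div vandermonde (varX ^ d) (varY ^ d) (varZ ^ d))"

text \<open>The division in \<^const>\<open>T_poly\<close> is exact; see \<open>T_poly_mult_vandermonde\<close> below.\<close>

lemma gen_vandermonde_expand:
  "gen_vandermonde A B x y z =
     (x ^ A - z ^ A) * (y ^ B - z ^ B) - (y ^ A - z ^ A) * (x ^ B - z ^ B)"
  by (simp add: gen_vandermonde_def det_3 algebra_simps)

lemma gen_vandermonde_mult:
  "gen_vandermonde (d * a) (d * b) x y z = gen_vandermonde a b (x ^ d) (y ^ d) (z ^ d)"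
  by (simp add: gen_vandermonde_expand power_mult)

lemma vandermonde_dvd_gen_vandermonde:
  fixes x y z :: "'r::comm_ring_1"
  shows "vandermonde x y z dvd gen_vandermonde a b x y z"
proof -
  define h where "h n u = (\<Sum>i<n. z ^ (n - Suc i) * u ^ i)" for n and u :: 'r
  have pow: "u ^ n - z ^ n = (u - z) * h n u" for n u
    unfolding h_def by (rule power_diff_sumr2)
  have diff: "x - y dvd h n x - h n y" for n
  proof -
    have "x - y dvd x ^ i - y ^ i" for i
      by (metis dvd_triv_left power_diff_sumr2)
    then have "x - y dvd z ^ (n - Suc i) * (x ^ i - y ^ i)" for i
      by (rule dvd_mult)
    then show ?thesis
      unfolding h_def sum_subtractf [symmetric] right_diff_distrib [symmetric]
      by (intro dvd_sum)
  qed
  have "x - y dvd (h a x - h a y) * h b y - h a y * (h b x - h b y)"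
    by (intro dvd_diff dvd_mult2 dvd_mult diff)
  then obtain c where
    c: "(h a x - h a y) * h b y - h a y * (h b x - h b y) = (x - y) * c" ..
  have "gen_vandermonde a b x y z =
      (x - z) * (y - z) * ((h a x - h a y) * h b y - h a y * (h b x - h b y))"
    by (simp add: gen_vandermonde_expand pow algebra_simps)
  also have "\<dots> = vandermonde x y z * c"
    unfolding c vandermonde_def by (simp add: algebra_simps)
  finally show ?thesis by simp
qed

lemma T_poly_mult_vandermonde:
  fixes A B :: nat
  defines "d \<equiv> gcd A B"
  shows "T_poly A B * vandermonde (varX ^ d) (varY ^ d) (varZ ^ d) =
    (gen_vandermonde A B varX varY varZ :: 'k::field poly poly poly)"
proof -
  obtain a b where "A = d * a" "B = d * b"
    unfolding d_def by (meson dvd_def gcd_dvd1 gcd_dvd2)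
  then have "vandermonde (varX ^ d) (varY ^ d) (varZ ^ d) dvd
      (gen_vandermonde A B varX varY varZ :: 'k poly poly poly)"
    by (metis gen_vandermonde_mult vandermonde_dvd_gen_vandermonde)
  then show ?thesis
    by (simp add: T_poly_def d_def Let_def)
qed

end

(*
Put Y = 1 and let tau(x, z) be the resulting polynomial. If T = F G then tau = f g, and the
argument is Bezout's theorem for the curves f = 0 and g = 0.

A point where three points of the curve (u^A, u^B) in the plane lie on a line is singular for R
only if that line is tangent at all three, which forces two of them to coincide. Counting the
order of vanishing of R at such coincidences shows that tau is smooth at all points with x /= 0.
Hence f and g do not meet there, and their Sylvester determinant with respect to z is c x^N.

Over k((x)) the polynomial tau splits by Hensel's lemma: B - d branches pass through the coordinate
point with distinct tangents, and the other A - B - d have distinct nonzero constant terms.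
The product formula then gives N = e e', where f and g contain e and e' of the former. As T
is homogeneous and symmetric up to sign, the same branches, divided by x, are the roots at
x = infinity, which gives a second expression for N. The two are compatible only if f or g has
degree 0 in z, and then it is constant.
*)

theory Submission
  imports Defs "Jordan_Normal_Form.Char_Poly"
begin

section \<open>Sylvester determinants\<close>

text \<open>Let \<open>f\<close> and \<open>g\<close> have degrees m and n in z, with leading
  coefficients of degrees l and l' in x. The curves F = 0 and G = 0 then have degrees m + l and n +
  l', and multiplicities l and l' at [0:0:1]. Let e, e' and i, i' be the numbers of their branches
  at [0:1:0] and [1:0:0], which lie over x = 0 and x = infinity. All three points are alike: e + e'
  = i + i' = l + l' = B - d. The number B - d counts the B-th roots of unity that are not d-th
  roots; these are the tangent directions that remain when V is removed. Without further
  intersections, Bezout reads e e' + i i' + l l' = (m + l)(n + l'). The term l l' cancels, and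
  elementary estimates leave m n = 0. One determinant in x replaces local intersection
  multiplicities, so that only its orders at two places of k(x) have to be known. If A = 2B, then R
  = V(X^d, Y^d, Z^d) and T = 1; the condition A \<noteq> 2B enters as A > 2d.\<close>

definition coeff_mat :: "nat \<Rightarrow> (nat \<Rightarrow> 'a poly) \<Rightarrow> 'a::comm_ring_1 Matrix.mat" where
  "coeff_mat n P = Matrix.mat n n (\<lambda>(i, j). coeff (P i) j)"

definition powers_mat :: "nat \<Rightarrow> (nat \<Rightarrow> 'a) \<Rightarrow> 'a::comm_ring_1 Matrix.mat" where
  "powers_mat n x = Matrix.mat n n (\<lambda>(i, j). x j ^ i)"

definition sylvester_rows :: "nat \<Rightarrow> 'a::comm_ring_1 poly \<Rightarrow> 'a poly \<Rightarrow> nat \<Rightarrow> 'a poly" where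
  "sylvester_rows m F G i = (if i < m then monom 1 i * G else monom 1 (i - m) * F)"

text \<open>The formal degrees m of \<open>F\<close> and n of \<open>G\<close> are arguments, so
  that the determinant commutes with every ring homomorphism, even one that lowers a degree. With
  the rows of \<open>G\<close> on top and ascending coefficients, no sign appears for monic
  \<open>F\<close> and \<open>G = 1\<close>.\<close>

definition sylvester_det :: "nat \<Rightarrow> nat \<Rightarrow> 'a::comm_ring_1 poly \<Rightarrow> 'a poly \<Rightarrow> 'a" where
  "sylvester_det m n F G = Determinant.det (coeff_mat (m + n) (sylvester_rows m F G))"

lemma coeff_mat_carrier [simp]: "coeff_mat n P \<in> carrier_mat n n"
  by (simp add: coeff_mat_def)

lemma powers_mat_carrier [simp]: "powers_mat n x \<in> carrier_mat n n"
  by (simp add: powers_mat_def)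

lemma poly_as_sum_lessThan:
  fixes p :: "'a::comm_ring_1 poly"
  assumes "degree p < n"
  shows "poly p x = (\<Sum>j<n. coeff p j * x ^ j)"
proof -
  have "poly p x = (\<Sum>j\<le>degree p. coeff p j * x ^ j)" by (rule poly_altdef)
  also have "\<dots> = (\<Sum>j<n. coeff p j * x ^ j)"
    by (rule sum.mono_neutral_left) (use assms in \<open>auto simp: coeff_eq_0\<close>)
  finally show ?thesis .
qed

lemma coeff_mat_mult_powers_mat:
  assumes "\<And>i. i < n \<Longrightarrow> degree (P i) < n"
  shows "coeff_mat n P * powers_mat n x = Matrix.mat n n (\<lambda>(i, j). poly (P i) (x j))"
  by (rule eq_matI)
    (simp_all add: coeff_mat_def powers_mat_def scalar_prod_def poly_as_sum_lessThan [OF assms]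
      lessThan_atLeast0)

lemma det_scale_columns:
  "Determinant.det (Matrix.mat n n (\<lambda>(i, j). f i j * c j)) =
    Determinant.det (Matrix.mat n n (\<lambda>(i, j). f i j)) * (\<Prod>j<n. c j :: 'a::comm_ring_1)"
proof -
  have "(\<Prod>i = 0..<n. c (p i)) = (\<Prod>j<n. c j)" if "p permutes {0..<n}" for p
    using prod.permute [OF that, of c] by (simp add: o_def lessThan_atLeast0)
  then show ?thesis
    by (simp add: Determinant.det_def prod.distrib sum_distrib_right mult.assoc)
qed

lemma degree_sylvester_rows_less:
  assumes "degree F \<le> m" "degree G \<le> n" "i < m + n"
  shows "degree (sylvester_rows m F G i) < m + n"
  using assms degree_mult_le [of "monom 1 i" G] degree_mult_le [of "monom 1 (i - m)" F]
    degree_monom_le [of "1::'a" i] degree_monom_le [of "1::'a" "i - m"]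
  by (auto simp: sylvester_rows_def)

text \<open>At a list of points beginning with \<open>m\<close> roots of \<open>F\<close>, the value matrix of the Sylvester
  rows is block triangular.\<close>
lemma sylvester_det_mult_powers_mat:
  fixes F G :: "'a::idom poly"
  assumes F: "degree F \<le> m" and G: "degree G \<le> n"
    and root: "\<And>j. j < m \<Longrightarrow> poly F (x j) = 0"
  shows "sylvester_det m n F G * Determinant.det (powers_mat (m + n) x) =
    (Determinant.det (powers_mat m x) * (\<Prod>j<m. poly G (x j))) *
    (Determinant.det (powers_mat n (\<lambda>j. x (m + j))) * (\<Prod>j<n. poly F (x (m + j))))"
proof -
  let ?M = "Matrix.mat (m + n) (m + n) (\<lambda>(i, j). poly (sylvester_rows m F G i) (x j))"
  let ?UL = "Matrix.mat m m (\<lambda>(i, j). x j ^ i * poly G (x j))"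
  let ?UR = "Matrix.mat m n (\<lambda>(i, j). x (m + j) ^ i * poly G (x (m + j)))"
  let ?LR = "Matrix.mat n n (\<lambda>(i, j). x (m + j) ^ i * poly F (x (m + j)))"
  have "sylvester_det m n F G * Determinant.det (powers_mat (m + n) x) =
      Determinant.det (coeff_mat (m + n) (sylvester_rows m F G) * powers_mat (m + n) x)"
    unfolding sylvester_det_def by (subst det_mult [where n = "m + n"]) auto
  also have "coeff_mat (m + n) (sylvester_rows m F G) * powers_mat (m + n) x = ?M"
    by (rule coeff_mat_mult_powers_mat) (rule degree_sylvester_rows_less [OF F G])
  also have "?M = four_block_mat ?UL ?UR (0\<^sub>m n m) ?LR"
    by (rule eq_matI) (auto simp: sylvester_rows_def poly_monom root)
  also have "Determinant.det \<dots> = Determinant.det ?UL * Determinant.det ?LR"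
    by (rule det_four_block_mat_lower_left_zero [where n = m and m = n]) auto
  also have "Determinant.det ?UL = Determinant.det (powers_mat m x) * (\<Prod>j<m. poly G (x j))"
    unfolding powers_mat_def by (rule det_scale_columns)
  also have "Determinant.det ?LR =
      Determinant.det (powers_mat n (\<lambda>j. x (m + j))) * (\<Prod>j<n. poly F (x (m + j)))"
    unfolding powers_mat_def by (rule det_scale_columns)
  finally show ?thesis .
qed

definition root_poly :: "nat \<Rightarrow> (nat \<Rightarrow> 'a) \<Rightarrow> 'a::comm_ring_1 poly" where
  "root_poly m x = (\<Prod>j<m. [:- x j, 1:])"

lemma poly_root_poly: "poly (root_poly m x) y = (\<Prod>j<m. y - x j)"
  by (simp add: root_poly_def poly_prod)

lemma monic_root_poly: "degree (root_poly m x) = m \<and> coeff (root_poly m x) m = (1::'a::idom)"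
proof -
  have "degree (root_poly m x) = m"
    unfolding root_poly_def by (subst degree_prod_sum_eq) auto
  moreover have "lead_coeff (root_poly m x) = 1"
    unfolding root_poly_def by (subst lead_coeff_prod) auto
  ultimately show ?thesis by simp
qed

text \<open>For \<open>G = 1\<close>, row i is monic of degree i, so the matrix is triangular with
  ones on the diagonal.\<close>

lemma sylvester_det_root_poly_1: "sylvester_det m n (root_poly m x) (1 :: 'a::idom poly) = 1"
proof -
  let ?S = "coeff_mat (m + n) (sylvester_rows m (root_poly m x) 1)"
  have deg: "degree (sylvester_rows m (root_poly m x) 1 i) = i \<and>
      coeff (sylvester_rows m (root_poly m x) 1 i) i = 1" for i
  proof (cases "i < m")
    case False
    moreover have "degree (monom 1 (i - m) * root_poly m x) = (i - m) + m"
      using monic_root_poly [of m x] by (subst degree_mult_eq) (auto simp: degree_monom_eq)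
    moreover have "coeff (monom 1 (i - m) * root_poly m x) i = coeff (root_poly m x) m"
      using False by (simp add: coeff_monom_mult)
    ultimately show ?thesis
      using monic_root_poly [of m x] by (simp add: sylvester_rows_def)
  qed (simp add: sylvester_rows_def degree_monom_eq)
  have "Determinant.det ?S = prod_list (diag_mat ?S)"
    by (rule det_lower_triangular [where n = "m + n"])
      (auto simp: coeff_mat_def deg coeff_eq_0)
  also have "\<dots> = 1"
    by (simp add: prod_list_diag_prod coeff_mat_def deg)
  finally show ?thesis by (simp add: sylvester_det_def)
qed

text \<open>The case \<open>G = 1\<close> of the block identity, where \<open>F\<close> has the
  first m points as its roots.\<close>

lemma det_powers_mat_append:
  fixes x :: "nat \<Rightarrow> 'a::idom"
  shows "Determinant.det (powers_mat (m + n) x) = Determinant.det (powers_mat m x) *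
    (Determinant.det (powers_mat n (\<lambda>j. x (m + j))) * (\<Prod>j<n. poly (root_poly m x) (x (m + j))))"
proof -
  have "poly (root_poly m x) (x j) = 0" if "j < m" for j
    using that by (auto simp: poly_root_poly)
  from sylvester_det_mult_powers_mat [of "root_poly m x" m 1 n x, OF _ _ this]
  show ?thesis using monic_root_poly [of m x] by (simp add: sylvester_det_root_poly_1)
qed

lemma det_powers_mat_nonzero:
  fixes x :: "nat \<Rightarrow> 'a::idom"
  shows "inj_on x {..<n} \<Longrightarrow> Determinant.det (powers_mat n x) \<noteq> 0"
proof (induction n)
  case 0
  then show ?case by (simp add: powers_mat_def)
next
  case (Suc n)
  then have "Determinant.det (powers_mat n x) \<noteq> 0"
    by (auto simp: inj_on_def)
  moreover have "Determinant.det (powers_mat 1 y) = (1::'a)" for y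
    by (subst det_single) (auto simp: powers_mat_def)
  moreover have "poly (root_poly n x) (x n) \<noteq> 0"
    using Suc.prems by (auto simp: poly_root_poly dest: inj_onD [of x _ n])
  ultimately show ?case
    using det_powers_mat_append [of n 1 x] by simp
qed

text \<open>By the block identity, both sides agree after multiplication by the Vandermonde
  determinant of all m + n points, which is nonzero and cancels. The last n points are
  auxiliary.\<close>

lemma sylvester_det_eq_prod:
  fixes F G :: "'a::idom poly"
  assumes F: "F = Polynomial.smult c (root_poly m x)" and G: "degree G \<le> n" and inj: "inj_on x {..<m + n}"
  shows "sylvester_det m n F G = c ^ n * (\<Prod>j<m. poly G (x j))"
proof -
  let ?W = "Determinant.det (powers_mat m x)"
  let ?W' = "Determinant.det (powers_mat n (\<lambda>j. x (m + j)))"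
  let ?Q = "\<Prod>j<n. poly (root_poly m x) (x (m + j))"
  have "degree F \<le> m"
    using monic_root_poly [of m x] by (metis F degree_smult_le)
  moreover have "poly F (x j) = 0" if "j < m" for j
    using that by (auto simp: F poly_root_poly)
  ultimately have "sylvester_det m n F G * Determinant.det (powers_mat (m + n) x) =
      (?W * (\<Prod>j<m. poly G (x j))) * (?W' * (\<Prod>j<n. poly F (x (m + j))))"
    by (rule sylvester_det_mult_powers_mat [OF _ G])
  also have "(\<Prod>j<n. poly F (x (m + j))) = c ^ n * ?Q"
    by (simp add: F prod.distrib)
  also have "(?W * (\<Prod>j<m. poly G (x j))) * (?W' * (c ^ n * ?Q)) =
      (c ^ n * (\<Prod>j<m. poly G (x j))) * Determinant.det (powers_mat (m + n) x)"
    by (simp add: det_powers_mat_append)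
  finally show ?thesis
    using det_powers_mat_nonzero [OF inj] by simp
qed

lemma poly_eq_smult_prod_roots:
  fixes F :: "'a::field poly"
  assumes "finite I" "card I = degree F" "\<And>a. a \<in> I \<Longrightarrow> poly F a = 0"
  shows "F = Polynomial.smult (lead_coeff F) (\<Prod>a\<in>I. [:- a, 1:])"
proof (rule ccontr)
  let ?P = "\<Prod>a\<in>I. [:- a, 1:]"
  let ?D = "F - Polynomial.smult (lead_coeff F) ?P"
  assume "\<not> ?thesis"
  then have D: "?D \<noteq> 0" by simp
  have deg: "degree ?P = degree F"
    by (subst degree_prod_sum_eq) (use assms in auto)
  have "lead_coeff ?P = 1"
    by (subst lead_coeff_prod) auto
  then have "coeff ?D (degree F) = 0" by (simp add: deg)
  moreover have "degree ?D \<le> degree F"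
    by (intro degree_diff_le) (auto simp: deg)
  ultimately have less: "degree ?D < degree F \<or> degree F = 0"
    by (metis D le_neq_implies_less leading_coeff_0_iff)
  have "degree F \<noteq> 0"
  proof
    assume "degree F = 0"
    then obtain c where "F = [:c:]" by (meson degree_eq_zeroE)
    then show False using D assms by simp
  qed
  moreover have "I \<subseteq> {x. poly ?D x = 0}"
    using assms by (auto simp: poly_prod)
  then have "card I \<le> card {x. poly ?D x = 0}"
    by (intro card_mono poly_roots_finite D)
  then have "degree F \<le> degree ?D"
    using card_poly_roots_bound [OF D] assms by linarith
  ultimately show False using less by linarith
qed

text \<open>At most \<open>degree F\<close> of the points are roots of \<open>F\<close> and at most
  \<open>degree G\<close> are roots of \<open>G\<close>, so the count forces a disjoint splitting.
  The roots of \<open>G\<close> then serve as the auxiliary points of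
  \<open>sylvester_det_eq_prod\<close>.\<close>

lemma sylvester_det_split:
  fixes F G :: "'a::field poly"
  assumes nz: "F \<noteq> 0" "G \<noteq> 0" and fin: "finite \<Omega>" and card: "card \<Omega> = degree F + degree G"
    and root: "\<And>w. w \<in> \<Omega> \<Longrightarrow> poly F w * poly G w = 0"
  obtains I J where "I \<inter> J = {}" "I \<union> J = \<Omega>" "card I = degree F" "card J = degree G"
    "sylvester_det (degree F) (degree G) F G =
      lead_coeff F ^ degree G * lead_coeff G ^ degree F * (\<Prod>a\<in>I. \<Prod>b\<in>J. a - b)"
proof -
  let ?m = "degree F" and ?n = "degree G"
  define I where "I = {w \<in> \<Omega>. poly F w = 0}"
  define J where "J = {w \<in> \<Omega>. poly G w = 0}"
  have fin': "finite I" "finite J" using fin by (auto simp: I_def J_def)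
  have un: "I \<union> J = \<Omega>" using root by (auto simp: I_def J_def)
  have "card I \<le> card {x. poly F x = 0}"
    by (intro card_mono poly_roots_finite nz) (auto simp: I_def)
  moreover have "card J \<le> card {x. poly G x = 0}"
    by (intro card_mono poly_roots_finite nz) (auto simp: J_def)
  ultimately have le: "card I \<le> ?m" "card J \<le> ?n"
    using card_poly_roots_bound [OF nz(1)] card_poly_roots_bound [OF nz(2)] by linarith+
  have "card \<Omega> + card (I \<inter> J) = card I + card J"
    using card_Un_Int [OF fin'] un by simp
  then have cards: "card I = ?m" "card J = ?n" "card (I \<inter> J) = 0"
    using le card by linarith+
  then have disj: "I \<inter> J = {}" using fin' by auto
  obtain x where x: "bij_betw x {..<?m} I"
    using ex_bij_betw_nat_finite [OF fin'(1)] cards by (auto simp: lessThan_atLeast0)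
  obtain y where y: "bij_betw y {..<?n} J"
    using ex_bij_betw_nat_finite [OF fin'(2)] cards by (auto simp: lessThan_atLeast0)
  define u where "u j = (if j < ?m then x j else y (j - ?m))" for j
  have u: "bij_betw u {..<?m} I"
    using x by (subst bij_betw_cong [of _ u x]) (auto simp: u_def)
  have "inj_on u {..<?m + ?n}"
  proof (rule inj_onI)
    fix i j assume ij: "i \<in> {..<?m + ?n}" "j \<in> {..<?m + ?n}" "u i = u j"
    have I: "u l \<in> I \<longleftrightarrow> l < ?m" if "l < ?m + ?n" for l
    proof (cases "l < ?m")
      case False
      then have "u l \<in> J" using y that by (auto simp: u_def bij_betw_def)
      then show ?thesis using False disj by auto
    qed (use u in \<open>auto simp: bij_betw_def\<close>)
    show "i = j"
    proof (cases "i < ?m")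
      case True
      then have "j < ?m" using I ij by (metis lessThan_iff)
      then show ?thesis using True u ij by (auto simp: bij_betw_def inj_on_def)
    next
      case False
      then have "\<not> j < ?m" using I ij by (metis lessThan_iff)
      then have "y (i - ?m) = y (j - ?m)" "i - ?m \<in> {..<?n}" "j - ?m \<in> {..<?n}"
        using False ij by (auto simp: u_def)
      then have "i - ?m = j - ?m" using y by (meson bij_betw_def inj_onD)
      then show ?thesis using False \<open>\<not> j < ?m\<close> by linarith
    qed
  qed
  moreover have "F = Polynomial.smult (lead_coeff F) (root_poly ?m u)"
  proof -
    have "(\<Prod>a\<in>I. [:- a, 1:]) = root_poly ?m u"
      unfolding root_poly_def by (rule prod.reindex_bij_betw [OF u, symmetric])
    then show ?thesis
      using poly_eq_smult_prod_roots [OF fin'(1) cards(1)] by (simp add: I_def)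
  qed
  ultimately have "sylvester_det ?m ?n F G = lead_coeff F ^ ?n * (\<Prod>j<?m. poly G (u j))"
    by (intro sylvester_det_eq_prod) auto
  also have "(\<Prod>j<?m. poly G (u j)) = (\<Prod>a\<in>I. poly G a)"
    by (rule prod.reindex_bij_betw [OF u])
  also have "\<dots> = (\<Prod>a\<in>I. lead_coeff G * (\<Prod>b\<in>J. a - b))"
  proof (rule prod.cong [OF refl])
    fix a
    have "G = Polynomial.smult (lead_coeff G) (\<Prod>b\<in>J. [:- b, 1:])"
      by (rule poly_eq_smult_prod_roots [OF fin'(2) cards(2)]) (auto simp: J_def)
    then have "poly G a = poly (Polynomial.smult (lead_coeff G) (\<Prod>b\<in>J. [:- b, 1:])) a"
      by simp
    then show "poly G a = lead_coeff G * (\<Prod>b\<in>J. a - b)"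
      by (simp add: poly_prod)
  qed
  also have "\<dots> = lead_coeff G ^ ?m * (\<Prod>a\<in>I. \<Prod>b\<in>J. a - b)"
    by (simp add: prod.distrib cards)
  finally show thesis
    using that [OF disj un cards(1,2)] by (simp add: mult.assoc)
qed

text \<open>Linear factors of \<open>F\<close> are cancelled one at a time: a root of
  \<open>F\<close> is not a root of \<open>G\<close>, hence it is a root of
  \<open>U\<close>.\<close>

lemma dvd_mult_no_common_root:
  fixes F G U :: "'a::alg_closed_field poly"
  assumes "F \<noteq> 0" "F dvd U * G" "\<And>x. poly F x = 0 \<Longrightarrow> poly G x \<noteq> 0"
  shows "F dvd U"
  using assms
proof (induction "degree F" arbitrary: F U)
  case 0
  then have "is_unit F" by (simp add: is_unit_iff_degree)
  then show ?case by (rule unit_imp_dvd)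
next
  case (Suc k)
  obtain a where a: "poly F a = 0"
    using alg_closed_imp_poly_has_root [of F] Suc.hyps by auto
  then obtain F' where F': "F = [:- a, 1:] * F'" by (auto simp: poly_eq_0_iff_dvd)
  have "poly (U * G) a = 0"
    using Suc.prems(2) a by (metis dvdE mult_zero_left poly_mult)
  then have "poly U a = 0" using Suc.prems(3) [OF a] by simp
  then obtain U' where U': "U = [:- a, 1:] * U'" by (auto simp: poly_eq_0_iff_dvd)
  have "F' dvd U' * G"
    using Suc.prems(2) unfolding F' U' mult.assoc by (subst (asm) dvd_mult_cancel_left) simp
  moreover have "F' \<noteq> 0" using Suc.prems(1) F' by auto
  moreover have "k = degree F'"
    using Suc.hyps \<open>F' \<noteq> 0\<close> unfolding F' by (subst (asm) degree_mult_eq) auto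
  moreover have "poly G x \<noteq> 0" if "poly F' x = 0" for x
    using Suc.prems(3) [of x] that by (simp add: F')
  ultimately have "F' dvd U'"
    using Suc.hyps(1) [of F' U'] by blast
  then show ?case unfolding F' U' by (intro mult_dvd_mono) auto
qed

text \<open>A dependence between the rows is a relation \<open>U * G + V * F = 0\<close> with
  \<open>U\<close> and \<open>V\<close> of degrees below m and n. If \<open>F\<close> has degree
  exactly m, then \<open>F\<close> divides \<open>U\<close>, so \<open>U = 0\<close>; likewise for
  \<open>G\<close>. The assumption \<open>full\<close> excludes a common root at infinity.\<close>

lemma sylvester_det_nonzero:
  fixes F G :: "'a::alg_closed_field poly"
  assumes F: "degree F \<le> m" and G: "degree G \<le> n"
    and cop: "\<And>x. poly F x = 0 \<Longrightarrow> poly G x \<noteq> 0"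
    and full: "F \<noteq> 0 \<and> degree F = m \<or> G \<noteq> 0 \<and> degree G = n"
  shows "sylvester_det m n F G \<noteq> 0"
proof
  let ?R = "sylvester_rows m F G"
  let ?A = "coeff_mat (m + n) ?R"
  assume "sylvester_det m n F G = 0"
  then have "Determinant.det (transpose_mat ?A) = 0"
    by (subst det_transpose [where n = "m + n"]) (auto simp: sylvester_det_def)
  then obtain v where v: "v \<in> carrier_vec (m + n)" "v \<noteq> 0\<^sub>v (m + n)"
      "transpose_mat ?A *\<^sub>v v = 0\<^sub>v (m + n)"
    using det_0_iff_vec_prod_zero [of "transpose_mat ?A" "m + n"] by auto
  \<comment> \<open>The kernel vector of the transpose lists the coefficients of \<open>U\<close>,
    followed by those of \<open>V\<close>.\<close>
  define c where "c i = vec_index v i" for i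
  define U where "U = (\<Sum>i<m. monom (c i) i)"
  define V where "V = (\<Sum>i<n. monom (c (m + i)) i)"
  have comb: "(\<Sum>i<m + n. coeff (?R i) j * c i) = 0" if "j < m + n" for j
  proof -
    have "vec_index (transpose_mat ?A *\<^sub>v v) j = (\<Sum>i<m + n. coeff (?R i) j * c i)"
      using that v(1) by (simp add: coeff_mat_def scalar_prod_def lessThan_atLeast0 c_def)
    then show ?thesis using that v(3) by simp
  qed
  have "(\<Sum>i<m + n. Polynomial.smult (c i) (?R i)) = 0"
  proof (rule poly_eqI)
    fix j
    show "coeff (\<Sum>i<m + n. Polynomial.smult (c i) (?R i)) j = coeff 0 j"
    proof (cases "j < m + n")
      case True
      then show ?thesis using comb [OF True] by (simp add: coeff_sum mult.commute)
    next
      case False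
      then have "coeff (?R i) j = 0" if "i < m + n" for i
        using degree_sylvester_rows_less [OF F G that] by (intro coeff_eq_0) linarith
      then show ?thesis by (simp add: coeff_sum)
    qed
  qed
  moreover have "(\<Sum>i<m + n. Polynomial.smult (c i) (?R i)) = U * G + V * F"
  proof -
    have "{..<m + n} = {..<m} \<union> (\<lambda>i. m + i) ` {..<n}"
      by (auto simp: image_iff Bex_def intro: le_Suc_ex)
        (metis add_less_cancel_left le_Suc_ex not_less)
    then have "(\<Sum>i<m + n. Polynomial.smult (c i) (?R i)) =
        (\<Sum>i<m. Polynomial.smult (c i) (?R i)) + (\<Sum>i<n. Polynomial.smult (c (m + i)) (?R (m + i)))"
      by (subst \<open>{..<m + n} = _\<close>, subst sum.union_disjoint) (auto simp: sum.reindex)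
    then show ?thesis
      by (simp add: sylvester_rows_def U_def V_def sum_distrib_right smult_monom
        flip: mult_smult_left)
  qed
  ultimately have UV: "U * G + V * F = 0" by simp
  have cU: "coeff U i = (if i < m then c i else 0)" for i
    by (simp add: U_def coeff_sum)
  have cV: "coeff V i = (if i < n then c (m + i) else 0)" for i
    by (simp add: V_def coeff_sum)
  have dU: "degree U < m" if "U \<noteq> 0"
    using that by (metis cU leading_coeff_0_iff)
  have dV: "degree V < n" if "V \<noteq> 0"
    using that by (metis cV leading_coeff_0_iff)
  from full have "U = 0 \<and> V = 0"
  proof
    assume *: "F \<noteq> 0 \<and> degree F = m"
    have "U * G = - V * F" using UV by (simp add: eq_neg_iff_add_eq_0)
    then have "F dvd U * G" by simp
    then have "F dvd U" using * cop by (intro dvd_mult_no_common_root [of F U G]) auto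
    then have "U = 0" using dU * dvd_imp_degree_le [of F U] by linarith
    then show ?thesis using UV * by simp
  next
    assume *: "G \<noteq> 0 \<and> degree G = n"
    have "V * F = - U * G" using UV by (simp add: eq_neg_iff_add_eq_0 add.commute)
    then have "G dvd V * F" by simp
    then have "G dvd V" using * cop by (intro dvd_mult_no_common_root [of G V F]) auto
    then have "V = 0" using dV * dvd_imp_degree_le [of G V] by linarith
    then show ?thesis using UV * by simp
  qed
  then have "c i = 0" if "i < m + n" for i
    using cU [of i] cV [of "i - m"] that by (cases "i < m") (auto split: if_splits)
  then have "v = 0\<^sub>v (m + n)"
    using v(1) by (intro eq_vecI) (auto simp: c_def)
  with v(2) show False by simp
qed

section \<open>Power series branches\<close>

lemma poly_taylor2:
  fixes P :: "'a::idom poly"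
  shows "\<exists>q. poly P (a + h) = poly P a + h * poly (pderiv P) a + h ^ 2 * q"
proof (induction P)
  case 0
  show ?case by (rule exI [of _ 0]) simp
next
  case (pCons c P)
  then obtain q where "poly P (a + h) = poly P a + h * poly (pderiv P) a + h ^ 2 * q" by blast
  then have "poly (pCons c P) (a + h) = poly (pCons c P) a + h * poly (pderiv (pCons c P)) a +
      h ^ 2 * (poly (pderiv P) a + a * q + h * q)"
    by (simp add: pderiv_pCons algebra_simps power2_eq_square)
  then show ?case by blast
qed

lemma fps_X_power_dvd_iff:
  fixes f :: "'a::comm_ring_1 fps"
  shows "fps_X ^ n dvd f \<longleftrightarrow> (\<forall>k<n. fps_nth f k = 0)"
proof
  assume "\<forall>k<n. fps_nth f k = 0"
  then have "f = fps_X ^ n * fps_shift n f"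
    by (intro fps_ext) (auto simp: fps_X_power_mult_nth)
  then show "fps_X ^ n dvd f" by (metis dvd_triv_left)
qed (auto simp: dvd_def fps_X_power_mult_nth)

lemma fps_nth_poly_0:
  fixes Q :: "'a::comm_ring_1 fps poly"
  shows "fps_nth (poly Q w) 0 = poly (map_poly (\<lambda>f. fps_nth f 0) Q) (fps_nth w 0)"
  by (induction Q) (auto simp: map_poly_pCons)

lemma pderiv_map_fps_nth_0:
  fixes Q :: "'a::idom fps poly"
  shows "pderiv (map_poly (\<lambda>f. fps_nth f 0) Q) = map_poly (\<lambda>f. fps_nth f 0) (pderiv Q)"
  by (rule poly_eqI) (simp add: coeff_pderiv coeff_map_poly fps_of_nat [symmetric] del: of_nat_Suc)

text \<open>Newton iteration that gains one coefficient at a time. The slope \<open>?D\<close> is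
  the constant term of the derivative at every approximation, so it stays the same
  throughout.\<close>

lemma fps_hensel:
  fixes P :: "'a::field fps poly"
  defines "p \<equiv> map_poly (\<lambda>f. fps_nth f 0) P"
  assumes root: "poly p z = 0" and simple: "poly (pderiv p) z \<noteq> 0"
  obtains w where "poly P w = 0" "fps_nth w 0 = z"
proof -
  let ?D = "poly (pderiv p) z"
  \<comment> \<open>To first order, this correction cancels the coefficient of
    \<open>fps_X ^ Suc n\<close> in \<open>poly P w\<close>.\<close>
  define e where "e n w = - fps_nth (poly P w) (Suc n) / ?D" for n w
  define W where "W = rec_nat (fps_const z) (\<lambda>n w. w + fps_X ^ Suc n * fps_const (e n w))"
  have W_Suc: "W (Suc n) = W n + fps_X ^ Suc n * fps_const (e n (W n))" for n
    by (simp add: W_def)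
  have W0: "fps_nth (W n) 0 = z" for n
    by (induction n) (simp_all add: W_Suc, simp add: W_def)
  have P_W: "fps_X ^ Suc n dvd poly P (W n)" for n
  proof (induction n)
    case 0
    show ?case
      using root W0 [of 0] by (simp add: fps_X_power_dvd_iff [of 1, simplified] fps_nth_poly_0 p_def)
  next
    case (Suc n)
    let ?h = "fps_X ^ Suc n * fps_const (e n (W n))"
    obtain q where q: "poly P (W n + ?h) =
        poly P (W n) + ?h * poly (pderiv P) (W n) + ?h ^ 2 * q"
      using poly_taylor2 by blast
    \<comment> \<open>The quadratic Taylor term has order at least 2n + 2 and does not reach the
      coefficients up to \<open>Suc n\<close>.\<close>
    have "?h ^ 2 * q = fps_X ^ (Suc n + Suc n) * (fps_const (e n (W n)) ^ 2 * q)"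
      unfolding power_add by (simp only: power2_eq_square ac_simps)
    then have "fps_X ^ (Suc n + Suc n) dvd ?h ^ 2 * q" by (metis dvd_triv_left)
    then have q0: "fps_nth (?h ^ 2 * q) k = 0" if "k \<le> Suc n" for k
      using that unfolding fps_X_power_dvd_iff by simp
    have D: "fps_nth (poly (pderiv P) (W n)) 0 = ?D"
      by (simp add: fps_nth_poly_0 W0 p_def pderiv_map_fps_nth_0)
    have step: "fps_nth (poly P (W (Suc n))) k =
        fps_nth (poly P (W n)) k + fps_nth (?h * poly (pderiv P) (W n)) k" if "k \<le> Suc n" for k
      by (simp only: W_Suc q fps_add_nth q0 [OF that] add_0_right)
    have "fps_nth (poly P (W (Suc n))) k = 0" if "k < Suc (Suc n)" for k
    proof (cases "k = Suc n")
      case True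
      have "fps_nth (?h * poly (pderiv P) (W n)) (Suc n) = e n (W n) * ?D"
        unfolding mult.assoc using D by (simp only: fps_X_power_mult_nth) simp
      then show ?thesis
        using simple step [of "Suc n"] by (simp add: True e_def)
    next
      case False
      then have k: "k < Suc n" using that by simp
      have "fps_nth (?h * poly (pderiv P) (W n)) k = 0"
        using k unfolding mult.assoc by (simp only: fps_X_power_mult_nth) simp
      moreover have "fps_nth (poly P (W n)) k = 0"
        using Suc.IH k unfolding fps_X_power_dvd_iff by blast
      ultimately show ?thesis
        using step [of k] k by simp
    qed
    then show ?case unfolding fps_X_power_dvd_iff by blast
  qed
  \<comment> \<open>Corrections after stage n leave coefficient n unchanged, so the limit is read
    off the diagonal.\<close>
  define w where "w = Abs_fps (\<lambda>n. fps_nth (W n) n)"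
  have stable: "fps_nth (W (k + m)) k = fps_nth (W k) k" for k m
  proof (induction m)
    case (Suc m)
    have "fps_nth (fps_X ^ Suc (k + m) * fps_const (e (k + m) (W (k + m)))) k = 0"
      by (simp only: fps_X_power_mult_nth) simp
    with Suc show ?case by (simp add: W_Suc del: power_Suc)
  qed simp
  have "fps_nth (poly P w) n = 0" for n
  proof -
    have "fps_nth (w - W n) k = 0" if "k < Suc n" for k
      using stable [of k "n - k"] that by (simp add: w_def)
    then have "fps_X ^ Suc n dvd w - W n"
      unfolding fps_X_power_dvd_iff by blast
    then obtain r where r: "w = W n + fps_X ^ Suc n * r"
      by (auto simp: dvd_def algebra_simps simp del: power_Suc)
    obtain q where "poly P w = poly P (W n) + fps_X ^ Suc n * r * poly (pderiv P) (W n) +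
        (fps_X ^ Suc n * r) ^ 2 * q"
      unfolding r using poly_taylor2 by blast
    then have "fps_X ^ Suc n dvd poly P w"
      using P_W [of n] by (simp add: power2_eq_square mult.assoc del: power_Suc)
    then show ?thesis unfolding fps_X_power_dvd_iff by blast
  qed
  then have "poly P w = 0" by (intro fps_ext) simp
  moreover have "fps_nth w 0 = z" by (simp add: w_def W0)
  ultimately show thesis by (rule that)
qed

section \<open>Branches of R(x, 1, z) = 0 at x = 0\<close>

lemma map_fps_nth_0_trinomial:
  fixes a b c :: "'a::comm_ring_1 fps"
  shows "map_poly (\<lambda>f. fps_nth f 0) (monom a m + monom b n + [:c:]) =
    monom (fps_nth a 0) m + monom (fps_nth b 0) n + [:fps_nth c 0:]"
  by (rule poly_eqI) (simp add: coeff_map_poly coeff_pCons split: nat.split)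

text \<open>At x = 0 the determinant becomes z^B - z^A. At a nonzero root, z times the derivative is
  (B - A) z^B, so the root is simple and lifts.\<close>

lemma branch_through_nonzero_point:
  fixes z :: "'k::field"
  assumes "B < A" "0 < B" and z: "z \<noteq> 0" "z ^ A = z ^ B" and ne: "of_nat A \<noteq> (of_nat B :: 'k)"
  obtains w where "fps_nth w 0 = z" "gen_vandermonde A B fps_X 1 w = 0"
proof -
  \<comment> \<open>The determinant as a trinomial in \<open>w\<close>: the two terms
    \<open>w ^ (A + B)\<close> of its expansion cancel.\<close>
  define P :: "'k fps poly" where
    "P = monom (- (1 - fps_X ^ B)) A + monom (1 - fps_X ^ A) B + [:fps_X ^ A - fps_X ^ B:]"
  let ?p = "map_poly (\<lambda>f. fps_nth f 0) P"
  have p: "?p = monom (- 1) A + monom 1 B"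
    using assms(1,2) unfolding P_def map_fps_nth_0_trinomial by simp
  have "poly ?p z = 0" by (simp add: p poly_monom z(2))
  moreover have "z * poly (pderiv ?p) z = (of_nat B - of_nat A) * z ^ B"
  proof -
    have "z * z ^ (n - 1) = z ^ n" if "0 < n" for n
      using that by (simp flip: power_Suc)
    then have pow: "z * z ^ (A - 1) = z ^ B" "z * z ^ (B - 1) = z ^ B"
      using assms(1,2) z(2) by auto
    have "z * poly (pderiv ?p) z = of_nat B * (z * z ^ (B - 1)) - of_nat A * (z * z ^ (A - 1))"
      by (simp add: p pderiv_add pderiv_monom poly_monom right_diff_distrib mult.left_commute)
    then show ?thesis unfolding pow by (simp add: left_diff_distrib)
  qed
  then have "poly (pderiv ?p) z \<noteq> 0" using z ne by auto
  ultimately obtain w where w: "poly P w = 0" "fps_nth w 0 = z"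
    by (rule fps_hensel)
  have "gen_vandermonde A B fps_X 1 w = poly P w"
    by (simp add: gen_vandermonde_expand P_def poly_monom algebra_simps)
  with w that show thesis by simp
qed

text \<open>Substituting \<open>fps_X * u\<close> and dividing by \<open>fps_X ^ B\<close> blows up
  the coordinate point. At x = 0 this leaves u^B - 1, whose roots are simple; they are the slopes of
  the branches.\<close>

lemma branch_through_corner:
  fixes z :: "'k::field"
  assumes "B < A" "0 < B" and z: "z ^ B = 1" and ne: "of_nat B \<noteq> (0 :: 'k)"
  obtains u where "fps_nth u 0 = z" "gen_vandermonde A B fps_X 1 (fps_X * u) = 0"
proof -
  define P :: "'k fps poly" where
    "P = monom (- (fps_X ^ (A - B) * (1 - fps_X ^ B))) A + monom (1 - fps_X ^ A) B
      + [:fps_X ^ (A - B) - 1:]"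
  let ?p = "map_poly (\<lambda>f. fps_nth f 0) P"
  have p: "?p = monom 1 B + [:- 1:]"
    using assms(1,2) unfolding P_def map_fps_nth_0_trinomial by simp
  have "poly ?p z = 0" by (simp add: p poly_monom z)
  moreover have "z \<noteq> 0" using z assms(2) by (auto simp: power_0_left)
  then have "poly (pderiv ?p) z \<noteq> 0"
    using ne by (simp add: p pderiv_add pderiv_monom poly_monom pderiv_pCons)
  ultimately obtain u where u: "poly P u = 0" "fps_nth u 0 = z"
    by (rule fps_hensel)
  obtain c where A: "A = B + c" using assms(1) by (auto dest: less_imp_add_positive)
  have "gen_vandermonde A B fps_X 1 (fps_X * u) = fps_X ^ B * poly P u"
    by (simp add: gen_vandermonde_expand P_def poly_monom algebra_simps power_mult_distrib A power_add)
  with u that show thesis by simp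
qed

section \<open>Counting branches by roots of unity\<close>

lemma card_roots_separable:
  fixes p :: "'a::alg_closed_field poly"
  assumes "p \<noteq> 0" "\<And>a. poly p a = 0 \<Longrightarrow> poly (pderiv p) a \<noteq> 0"
  shows "card {x. poly p x = 0} = degree p"
  using assms
proof (induction "degree p" arbitrary: p)
  case 0
  then obtain c where "p = [:c:]" by (metis degree_eq_zeroE)
  with 0 show ?case by auto
next
  case (Suc k)
  obtain a where a: "poly p a = 0"
    using alg_closed_imp_poly_has_root [of p] Suc.hyps by auto
  then obtain r where r: "p = [:- a, 1:] * r" by (auto simp: poly_eq_0_iff_dvd)
  have deriv: "poly (pderiv p) x = poly r x + (x - a) * poly (pderiv r) x" for x
    unfolding r pderiv_mult by (simp add: pderiv_pCons algebra_simps)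
  have "r \<noteq> 0" using Suc.prems(1) r by auto
  have "k = degree r"
    using Suc.hyps(2) \<open>r \<noteq> 0\<close> unfolding r by (subst (asm) degree_mult_eq) auto
  moreover have "poly (pderiv r) x \<noteq> 0" if "poly r x = 0" for x
    using Suc.prems(2) [of x] that deriv [of x] r by auto
  ultimately have "card {x. poly r x = 0} = k"
    using Suc.hyps(1) [of r] \<open>r \<noteq> 0\<close> by blast
  moreover have "{x. poly p x = 0} = insert a {x. poly r x = 0}"
    unfolding r by auto
  moreover have "poly r a \<noteq> 0"
    using Suc.prems(2) [OF a] deriv [of a] by simp
  ultimately show ?case
    using Suc.hyps(2) poly_roots_finite [OF \<open>r \<noteq> 0\<close>] by simp
qed

lemma card_roots_unity:
  assumes "of_nat n \<noteq> (0 :: 'k::alg_closed_field)"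
  shows "card {z :: 'k. z ^ n = 1} = n"
proof -
  let ?p = "monom 1 n - 1 :: 'k poly"
  have n: "0 < n" using assms by (cases n) auto
  have "degree ?p = n"
    using n degree_add_eq_left [of "- 1" "monom 1 n :: 'k poly"] by (simp add: degree_monom_eq)
  moreover have "?p \<noteq> 0" using \<open>degree ?p = n\<close> n by auto
  moreover have "poly (pderiv ?p) z \<noteq> 0" if "poly ?p z = 0" for z
  proof -
    have "z \<noteq> 0" using that n by (auto simp: poly_monom power_0_left)
    then show ?thesis using assms by (simp add: pderiv_diff pderiv_monom poly_monom)
  qed
  moreover have "{z. poly ?p z = 0} = {z. z ^ n = 1}" by (simp add: poly_monom)
  ultimately show ?thesis using card_roots_separable [of ?p] by simp
qed

text \<open>The characteristic enters only through A, B and A - B being nonzero in the field.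
  \<open>K\<close> makes the field a parameter, since the numbers do not determine its type.\<close>

locale exponents =
  fixes A B d :: nat and K :: "'k::alg_closed_field itself"
  assumes B_pos: "0 < B" and B_less_A: "B < A" and A_neq: "A \<noteq> 2 * B"
    and d_def: "d = gcd A B"
    and A_unit: "of_nat A \<noteq> (0 :: 'k)" and B_unit: "of_nat B \<noteq> (0 :: 'k)"
    and diff_unit: "of_nat A \<noteq> (of_nat B :: 'k)"
begin

lemma d_pos: "0 < d" and d_dvd_A: "d dvd A" and d_dvd_B: "d dvd B" and d_dvd_diff: "d dvd A - B"
  using B_pos by (auto simp: d_def dvd_diff_nat)

lemma diff_unit': "of_nat (A - B) \<noteq> (0 :: 'k)"
  using diff_unit B_less_A by (simp add: of_nat_diff)

lemma d_unit: "of_nat d \<noteq> (0 :: 'k)"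
  using B_unit d_dvd_B by (metis dvdE mult_zero_left of_nat_mult)

text \<open>A Bezout relation for the exponents, applied to \<open>x / y\<close>. It turns a
  coincidence of two points of the curve (u^A, u^B) into the vanishing of a factor of V in d-th
  powers.\<close>

lemma power_gcd_eq:
  fixes x y :: "'b::field"
  assumes "x ^ A = y ^ A" "x ^ B = y ^ B" "y \<noteq> 0"
  shows "x ^ d = y ^ d"
proof -
  obtain s t where st: "B * s = A * t + d"
    using bezout_nat [of B A] B_pos by (auto simp: d_def gcd.commute)
  have "(x / y) ^ A = 1" "(x / y) ^ B = 1"
    using assms by (simp_all add: power_divide)
  then have "(x / y) ^ (B * s) = 1" "(x / y) ^ (A * t) = 1"
    by (simp_all add: power_mult)
  then have "(x / y) ^ d = 1" unfolding st power_add by simp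
  then show ?thesis using assms(3) by (simp add: power_divide)
qed

text \<open>The d-th roots of unity belong to branches of V(x^d, 1, z^d) = 0, which have to be left
  out.\<close>

lemma card_roots_unity_diff:
  assumes "of_nat n \<noteq> (0 :: 'k)" "d dvd n"
  shows "card {z :: 'k. z ^ n = 1 \<and> z ^ d \<noteq> 1} = n - d"
proof -
  have fin: "finite {z :: 'k. z ^ d = 1}"
    using card_roots_unity [OF d_unit] d_pos by (intro card_ge_0_finite) simp
  have sub: "{z :: 'k. z ^ d = 1} \<subseteq> {z. z ^ n = 1}"
    using assms(2) by (auto simp: power_mult)
  have "{z :: 'k. z ^ n = 1 \<and> z ^ d \<noteq> 1} = {z. z ^ n = 1} - {z. z ^ d = 1}" by auto
  then show ?thesis
    using card_Diff_subset [OF fin sub] card_roots_unity [OF d_unit] card_roots_unity [OF assms(1)]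
    by simp
qed

text \<open>\<open>\<Omega>0\<close> lifts the nonzero constant terms and \<open>\<Omega>1\<close>
  the slopes at the coordinate point. Together there are A - 2d branches, as many as the degree of
  tau in z. As V does not vanish on them, they are roots of tau and not only of R. Two members of
  \<open>\<Omega>1\<close> differ in order exactly 1 because their slopes differ.\<close>

lemma branches:
  obtains \<Omega>0 \<Omega>1 :: "'k fps set"
  where "finite \<Omega>0" "finite \<Omega>1" "card \<Omega>0 = A - B - d" "card \<Omega>1 = B - d" "\<Omega>0 \<inter> \<Omega>1 = {}"
    "\<And>w. w \<in> \<Omega>0 \<union> \<Omega>1 \<Longrightarrow> gen_vandermonde A B fps_X 1 w = 0"
    "\<And>w. w \<in> \<Omega>0 \<union> \<Omega>1 \<Longrightarrow> vandermonde (fps_X ^ d) 1 (w ^ d) \<noteq> 0"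
    "\<And>v w. v \<in> \<Omega>0 \<union> \<Omega>1 \<Longrightarrow> w \<in> \<Omega>0 \<union> \<Omega>1 \<Longrightarrow> v \<noteq> w \<Longrightarrow>
      subdegree (v - w) = (if v \<in> \<Omega>1 \<and> w \<in> \<Omega>1 then 1 else 0)"
proof -
  define Z0 where "Z0 = {z :: 'k. z ^ (A - B) = 1 \<and> z ^ d \<noteq> 1}"
  define Z1 where "Z1 = {z :: 'k. z ^ B = 1 \<and> z ^ d \<noteq> 1}"
  have card: "card Z0 = A - B - d" "card Z1 = B - d"
    unfolding Z0_def Z1_def
    using card_roots_unity_diff diff_unit' d_dvd_diff B_unit d_dvd_B by auto
  have finZ: "finite Z0" "finite Z1"
  proof -
    have "finite {z :: 'k. z ^ n = 1}" if "of_nat n \<noteq> (0 :: 'k)" for n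
      using card_roots_unity [OF that] that by (intro card_ge_0_finite) (cases n; simp)
    then show "finite Z0" "finite Z1"
      unfolding Z0_def Z1_def using diff_unit' B_unit by (auto intro: rev_finite_subset)
  qed
  have Z0_nz: "z \<noteq> 0" if "z \<in> Z0" for z
    using that B_less_A by (auto simp: Z0_def power_0_left)
  have "\<exists>w. fps_nth w 0 = z \<and> gen_vandermonde A B fps_X 1 w = 0" if "z \<in> Z0" for z
  proof -
    have "z ^ A = z ^ (A - B) * z ^ B"
      using B_less_A by (simp flip: power_add)
    then have "z ^ A = z ^ B" using that by (simp add: Z0_def)
    then show ?thesis
      using branch_through_nonzero_point [OF B_less_A B_pos Z0_nz [OF that] _ diff_unit] by metis
  qed
  then obtain f where f: "\<And>z. z \<in> Z0 \<Longrightarrow> fps_nth (f z) 0 = z"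
      "\<And>z. z \<in> Z0 \<Longrightarrow> gen_vandermonde A B fps_X 1 (f z) = 0" by metis
  have "\<exists>u. fps_nth u 0 = z \<and> gen_vandermonde A B fps_X 1 (fps_X * u) = 0" if "z \<in> Z1" for z
    using branch_through_corner [OF B_less_A B_pos _ B_unit, of z] that unfolding Z1_def by blast
  then obtain g where g: "\<And>z. z \<in> Z1 \<Longrightarrow> fps_nth (g z) 0 = z"
      "\<And>z. z \<in> Z1 \<Longrightarrow> gen_vandermonde A B fps_X 1 (fps_X * g z) = 0" by metis
  define \<Omega>0 where "\<Omega>0 = f ` Z0"
  define \<Omega>1 where "\<Omega>1 = (\<lambda>z. fps_X * g z) ` Z1"
  have injf: "inj_on f Z0" by (metis f(1) inj_onI)
  have injg: "inj_on (\<lambda>z. fps_X * g z) Z1"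
    by (rule inj_onI) (metis g(1) mult_cancel_left fps_X_neq_zero)
  have nth0: "fps_nth w 0 \<in> Z0" if "w \<in> \<Omega>0" for w
    using that f by (auto simp: \<Omega>0_def)
  have nth1: "\<exists>u. w = fps_X * u \<and> fps_nth u 0 \<in> Z1" if "w \<in> \<Omega>1" for w
    using that g by (auto simp: \<Omega>1_def)
  have nth1': "fps_nth w 0 = 0" if "w \<in> \<Omega>1" for w
    using nth1 [OF that] by auto
  have pow0: "fps_nth (w ^ n) 0 = fps_nth w 0 ^ n" for w :: "'k fps" and n
    by (rule fps_nth_power_0)
  have nz: "h \<noteq> 0" if "fps_nth h 0 \<noteq> 0" for h :: "'k fps" using that by auto
  show thesis
  proof
    show "finite \<Omega>0" "finite \<Omega>1" by (simp_all add: \<Omega>0_def \<Omega>1_def finZ)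
    show "card \<Omega>0 = A - B - d" "card \<Omega>1 = B - d"
      by (simp_all add: \<Omega>0_def \<Omega>1_def card_image injf injg card)
    show "\<Omega>0 \<inter> \<Omega>1 = {}"
      using nth0 nth1' Z0_nz by (metis disjoint_iff)
    show "gen_vandermonde A B fps_X 1 w = 0" if "w \<in> \<Omega>0 \<union> \<Omega>1" for w
      using that f g by (auto simp: \<Omega>0_def \<Omega>1_def)
    show "vandermonde (fps_X ^ d) 1 (w ^ d) \<noteq> 0" if "w \<in> \<Omega>0 \<union> \<Omega>1" for w
    proof (cases "w \<in> \<Omega>0")
      case True
      then have z: "fps_nth w 0 ^ d \<noteq> 1" "fps_nth w 0 \<noteq> 0"
        using nth0 [OF True] Z0_nz by (auto simp: Z0_def)
      have "fps_nth (fps_X ^ d - 1 :: 'k fps) 0 \<noteq> 0" "fps_nth (w ^ d - fps_X ^ d) 0 \<noteq> 0"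
          "fps_nth (w ^ d - 1) 0 \<noteq> 0"
        using z d_pos by (simp_all add: pow0 power_0_left)
      from this [THEN nz] show ?thesis by (simp add: vandermonde_def)
    next
      case False
      then have "w \<in> \<Omega>1" using that by simp
      then obtain u where u: "w = fps_X * u" "fps_nth u 0 \<in> Z1" using nth1 by blast
      have "fps_nth (fps_X ^ d - 1 :: 'k fps) 0 \<noteq> 0" "fps_nth (w ^ d - 1) 0 \<noteq> 0"
          "fps_nth (u ^ d - 1) 0 \<noteq> 0"
        using u d_pos by (simp_all add: pow0 power_0_left Z1_def)
      note this [THEN nz]
      moreover have "w ^ d - fps_X ^ d = fps_X ^ d * (u ^ d - 1)"
        by (simp add: u power_mult_distrib algebra_simps)
      ultimately show ?thesis by (simp add: vandermonde_def)
    qed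
    show "subdegree (v - w) = (if v \<in> \<Omega>1 \<and> w \<in> \<Omega>1 then 1 else 0)"
      if vw: "v \<in> \<Omega>0 \<union> \<Omega>1" "w \<in> \<Omega>0 \<union> \<Omega>1" "v \<noteq> w" for v w
    proof (cases "v \<in> \<Omega>1 \<and> w \<in> \<Omega>1")
      case True
      then obtain y z where yz: "v = fps_X * g y" "w = fps_X * g z" "y \<in> Z1" "z \<in> Z1"
        by (auto simp: \<Omega>1_def)
      then have "fps_nth (g y - g z) 0 \<noteq> 0" using g vw(3) by auto
      then have "subdegree (g y - g z) = 0" "g y - g z \<noteq> 0" by (auto simp: subdegree_eq_0_iff)
      moreover have "v - w = fps_X * (g y - g z)" by (simp add: yz right_diff_distrib)
      ultimately show ?thesis using True by simp
    next
      case False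
      have "fps_nth v 0 \<noteq> fps_nth w 0"
      proof (cases "v \<in> \<Omega>0 \<and> w \<in> \<Omega>0")
        case True
        then show ?thesis using f vw(3) by (auto simp: \<Omega>0_def)
      next
        case F: False
        then show ?thesis using False vw(1,2) nth0 nth1' Z0_nz by (metis Un_iff)
      qed
      then have "subdegree (v - w) = 0" by (simp add: subdegree_eq_0_iff)
      then show ?thesis using False by simp
    qed
  qed
qed

end

section \<open>Valuations of Sylvester determinants\<close>

lemma sylvester_det_hom:
  assumes "comm_ring_hom h"
  shows "h (sylvester_det m n F G) = sylvester_det m n (map_poly h F) (map_poly h G)"
proof -
  interpret comm_ring_hom h by fact
  interpret P: map_poly_comm_ring_hom h ..
  have rows: "map_poly h (sylvester_rows m F G i) = sylvester_rows m (map_poly h F) (map_poly h G) i" for i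
    by (simp add: sylvester_rows_def P.hom_mult)
  have "map_mat h (coeff_mat k P) = coeff_mat k (\<lambda>i. map_poly h (P i))" for k P
    by (rule eq_matI) (auto simp: coeff_mat_def)
  then show ?thesis
    by (simp add: sylvester_det_def rows flip: hom_det)
qed

lemma comm_ring_hom_eval_poly:
  assumes "comm_ring_hom h"
  shows "comm_ring_hom (\<lambda>p. poly (map_poly h p) a)"
proof -
  interpret comm_ring_hom h by fact
  interpret P: map_poly_comm_ring_hom h ..
  show ?thesis by unfold_locales (simp_all add: P.hom_mult P.hom_add)
qed

lemma hom_gen_vandermonde:
  assumes "comm_ring_hom h"
  shows "h (gen_vandermonde A B x y z) = gen_vandermonde A B (h x) (h y) (h z)"
proof -
  interpret comm_ring_hom h by fact
  show ?thesis by (simp add: gen_vandermonde_expand hom_distribs)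
qed

lemma hom_vandermonde:
  assumes "comm_ring_hom h"
  shows "h (vandermonde x y z) = vandermonde (h x) (h y) (h z)"
proof -
  interpret comm_ring_hom h by fact
  show ?thesis by (simp add: vandermonde_def hom_distribs)
qed

text \<open>With \<open>fls_X\<close> for \<open>a\<close> this is the place x = 0 of k(x), with
  \<open>fls_X_inv\<close> the place at infinity.\<close>

definition fls_eval :: "'k::field fls \<Rightarrow> 'k poly \<Rightarrow> 'k fls" where
  "fls_eval a p = poly (map_poly fls_const p) a"

lemma comm_ring_hom_fls_const: "comm_ring_hom (fls_const :: 'k::field \<Rightarrow> 'k fls)"
  by unfold_locales (simp_all add: fls_plus_const fls_const_mult_const)

lemma comm_ring_hom_fls_eval: "comm_ring_hom (fls_eval a)"
  unfolding fls_eval_def by (rule comm_ring_hom_eval_poly [OF comm_ring_hom_fls_const])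

lemma fls_eval_pCons: "fls_eval a (pCons c p) = fls_const c + a * fls_eval a p"
proof -
  interpret comm_ring_hom "fls_const :: 'a \<Rightarrow> 'a fls" by (rule comm_ring_hom_fls_const)
  show ?thesis by (simp add: fls_eval_def map_poly_pCons_hom)
qed

lemma fls_eval_0 [simp]: "fls_eval a 0 = 0"
  by (simp add: fls_eval_def)

lemma fls_eval_X: "fls_eval fls_X p = fps_to_fls (fps_of_poly p)"
proof (induction p)
  case (pCons c p)
  have "fps_of_poly (pCons c p) = fps_const c + fps_X * fps_of_poly p"
    by (simp add: fps_of_poly_pCons mult.commute)
  then show ?case
    by (simp only: fls_eval_pCons pCons.IH fls_times_fps_to_fls fps_to_fls_plus fps_const_to_fls
      fps_X_to_fls)
qed simp

lemma fls_eval_X_subdegree_0: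
  assumes "poly p 0 \<noteq> 0"
  shows "fls_subdegree (fls_eval fls_X p) = 0"
  using assms by (simp add: fls_eval_X fls_subdegree_fls_to_fps subdegree_eq_0_iff poly_0_coeff_0)

text \<open>In each Horner step the product with \<open>fls_X_inv\<close> has negative order and
  dominates the added constant.\<close>

lemma fls_eval_X_inv:
  "p \<noteq> 0 \<Longrightarrow> fls_eval fls_X_inv p \<noteq> 0 \<and> fls_subdegree (fls_eval fls_X_inv p) = - int (degree p)"
proof (induction p)
  case (pCons c p)
  show ?case
  proof (cases "p = 0")
    case True
    then show ?thesis using pCons by (simp add: fls_eval_pCons fls_const_nonzero)
  next
    case False
    let ?q = "fls_X_inv * fls_eval fls_X_inv p"
    have q: "?q \<noteq> 0" "fls_subdegree ?q = - int (Suc (degree p))"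
      using pCons.IH [OF False] by simp_all
    have "fls_subdegree (?q + fls_const c) = fls_subdegree ?q"
      using q by (intro fls_subdegree_add_eq1) auto
    moreover have "?q + fls_const c \<noteq> 0"
    proof
      assume "?q + fls_const c = 0"
      then have "?q = fls_const (- c)" by (simp add: eq_neg_iff_add_eq_0)
      then show False using q(2) by simp
    qed
    ultimately show ?thesis
      using q False by (simp add: fls_eval_pCons add.commute)
  qed
qed simp

lemma fls_eval_monomial:
  "fls_eval a (Polynomial.smult c ([:0, 1:] ^ n)) = fls_const c * a ^ n"
proof -
  interpret comm_ring_hom "fls_eval a" by (rule comm_ring_hom_fls_eval)
  have "Polynomial.smult c ([:0, 1:] ^ n) = [:c:] * [:0, 1:] ^ n" by simp
  then show ?thesis
    by (simp only: hom_mult hom_power) (simp add: fls_eval_pCons)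
qed

lemma fls_eval_X_nonzero: "p \<noteq> 0 \<Longrightarrow> fls_eval fls_X p \<noteq> 0"
  by (simp add: fls_eval_X)

lemma fls_subdegree_prod_idom:
  fixes F :: "'a \<Rightarrow> 'b::idom fls"
  assumes "\<And>x. x \<in> I \<Longrightarrow> F x \<noteq> 0"
  shows "fls_subdegree (\<Prod>x\<in>I. F x) = (\<Sum>x\<in>I. fls_subdegree (F x))"
  using assms by (induction I rule: infinite_finite_induct) auto

text \<open>The product formula read at a place of \<open>k(x)\<close>: here \<open>\<Gamma>\<close> is the set of the branches
  that pass through a coordinate point.\<close>
lemma subdegree_sylvester_det:
  fixes f g :: "'k::field poly poly" and a :: "'k fls" and s :: int
  assumes nz: "f \<noteq> 0" "g \<noteq> 0"
    and inj: "\<And>p :: 'k poly. p \<noteq> 0 \<Longrightarrow> fls_eval a p \<noteq> 0"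
    and fin: "finite \<Omega>" and sub: "\<Gamma> \<subseteq> \<Omega>" and card: "card \<Omega> = degree f + degree g"
    and root: "\<And>w. w \<in> \<Omega> \<Longrightarrow>
      poly (map_poly (fls_eval a) f) w * poly (map_poly (fls_eval a) g) w = 0"
    and val: "\<And>v w. v \<in> \<Omega> \<Longrightarrow> w \<in> \<Omega> \<Longrightarrow> v \<noteq> w \<Longrightarrow>
      fls_subdegree (v - w) = (if v \<in> \<Gamma> \<and> w \<in> \<Gamma> then 1 else 0) - s"
  obtains e e' where "e \<le> degree f" "e' \<le> degree g" "e + e' = card \<Gamma>"
    "fls_subdegree (fls_eval a (sylvester_det (degree f) (degree g) f g)) =
      int (degree g) * fls_subdegree (fls_eval a (lead_coeff f)) +
      int (degree f) * fls_subdegree (fls_eval a (lead_coeff g)) +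
      int (e * e') - s * int (degree f * degree g)"
proof -
  interpret comm_ring_hom "fls_eval a" by (rule comm_ring_hom_fls_eval)
  have deg: "degree (map_poly (fls_eval a) p) = degree p" for p :: "'k poly poly"
    by (rule Polynomial.degree_map_poly) (use inj in auto)
  have lc: "lead_coeff (map_poly (fls_eval a) p) = fls_eval a (lead_coeff p)" for p :: "'k poly poly"
    by (simp add: deg)
  have nz': "map_poly (fls_eval a) f \<noteq> 0" "map_poly (fls_eval a) g \<noteq> 0"
    using nz inj lc by (metis leading_coeff_0_iff)+
  have "card \<Omega> = degree (map_poly (fls_eval a) f) + degree (map_poly (fls_eval a) g)"
    by (simp add: deg card)
  then obtain I J where IJ: "I \<inter> J = {}" "I \<union> J = \<Omega>" "card I = degree f" "card J = degree g"
    and det: "sylvester_det (degree f) (degree g) (map_poly (fls_eval a) f) (map_poly (fls_eval a) g) =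
      lead_coeff (map_poly (fls_eval a) f) ^ degree g *
      lead_coeff (map_poly (fls_eval a) g) ^ degree f * (\<Prod>v\<in>I. \<Prod>w\<in>J. v - w)"
    by (rule sylvester_det_split [OF nz' fin _ root]) (simp_all add: deg)
  have fin': "finite I" "finite J" using fin IJ by auto
  have ne: "v \<noteq> w" if "v \<in> I" "w \<in> J" for v w using that IJ by auto
  have "fls_subdegree (\<Prod>v\<in>I. \<Prod>w\<in>J. v - w) = (\<Sum>v\<in>I. fls_subdegree (\<Prod>w\<in>J. v - w))"
    using fin' ne by (intro fls_subdegree_prod_idom) auto
  also have "\<dots> = (\<Sum>v\<in>I. \<Sum>w\<in>J. fls_subdegree (v - w))"
    using fin' ne by (intro sum.cong refl fls_subdegree_prod_idom) auto
  \<comment> \<open>The order of a difference is a product of two indicators minus \<open>s\<close>,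
    so the double sum factors into the two branch counts. At infinity \<open>s\<close> is 1, because
    every branch is divided by the uniformizer there.\<close>
  also have "\<dots> = (\<Sum>v\<in>I. \<Sum>w\<in>J. of_bool (v \<in> \<Gamma>) * of_bool (w \<in> \<Gamma>) - s)"
    using IJ ne val by (intro sum.cong refl) auto
  also have "\<dots> = (\<Sum>v\<in>I. of_bool (v \<in> \<Gamma>)) * (\<Sum>w\<in>J. of_bool (w \<in> \<Gamma>)) -
      s * int (card I * card J)"
    by (simp add: sum_subtractf sum_product)
  also have "(\<Sum>v\<in>I. of_bool (v \<in> \<Gamma>)) = int (card (I \<inter> \<Gamma>))"
    using fin' by (simp add: sum.If_cases of_bool_def)
  also have "(\<Sum>v\<in>J. of_bool (v \<in> \<Gamma>)) = int (card (J \<inter> \<Gamma>))"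
    using fin' by (simp add: sum.If_cases of_bool_def)
  finally have prod: "fls_subdegree (\<Prod>v\<in>I. \<Prod>w\<in>J. v - w) =
      int (card (I \<inter> \<Gamma>)) * int (card (J \<inter> \<Gamma>)) - s * int (degree f * degree g)"
    by (simp add: IJ)
  have "(\<Prod>v\<in>I. \<Prod>w\<in>J. v - w) \<noteq> 0" using fin' ne by auto
  moreover have "fls_eval a (lead_coeff f) \<noteq> 0" "fls_eval a (lead_coeff g) \<noteq> 0"
    using inj nz by auto
  ultimately have "fls_subdegree (fls_eval a (sylvester_det (degree f) (degree g) f g)) =
      int (degree g) * fls_subdegree (fls_eval a (lead_coeff f)) +
      int (degree f) * fls_subdegree (fls_eval a (lead_coeff g)) +
      int (card (I \<inter> \<Gamma>) * card (J \<inter> \<Gamma>)) - s * int (degree f * degree g)"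
    unfolding sylvester_det_hom [OF comm_ring_hom_fls_eval] det lc
    by (simp add: prod fls_subdegree_pow)
  moreover have "card (I \<inter> \<Gamma>) + card (J \<inter> \<Gamma>) = card \<Gamma>"
  proof -
    have "(I \<inter> \<Gamma>) \<inter> (J \<inter> \<Gamma>) = {}" using IJ(1) by auto
    then have "card ((I \<inter> \<Gamma>) \<union> (J \<inter> \<Gamma>)) = card (I \<inter> \<Gamma>) + card (J \<inter> \<Gamma>)"
      by (intro card_Un_disjoint) (use fin' in auto)
    moreover have "(I \<inter> \<Gamma>) \<union> (J \<inter> \<Gamma>) = \<Gamma>" using IJ(2) sub by auto
    ultimately show ?thesis by simp
  qed
  moreover have "card (I \<inter> \<Gamma>) \<le> degree f" "card (J \<inter> \<Gamma>) \<le> degree g"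
    using fin' IJ by (metis card_mono inf_le1)+
  ultimately show thesis using that by blast
qed

text \<open>In \<open>eq\<close>, the left-hand side counts the intersections of \<open>f = 0\<close> and \<open>g = 0\<close> on the branches
  over \<open>x = 0\<close> and \<open>x = \<infinity>\<close>; the right-hand side is the degree of the homogenized resultant.\<close>
lemma bezout_count_trivial:
  fixes m n e e' i i' l l' r :: nat
  assumes "e \<le> m" "i \<le> m" "e' \<le> n" "i' \<le> n" "e + e' = r" "i + i' = r" "l + l' = r"
    and eq: "e * e' + i * i' = n * l + m * l' + m * n"
  shows "m = 0 \<or> n = 0"
proof -
  \<comment> \<open>By symmetry let i \<le> e, so e' \<le> i'. With t the smaller of e and i', n l +
    m l' \<ge> i' l + e l' \<ge> t r, and m n \<ge> e i' \<ge> e e'. With r written as i + i' or e +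
    e', these bounds contradict \<open>eq\<close> unless m n = 0.\<close>
  have main: "m * n = 0"
    if "e \<le> m" "i \<le> m" "e' \<le> n" "i' \<le> n" "e + e' = r" "i + i' = r"
      and eq: "e * e' + i * i' = n * l + m * l' + m * n" and "i \<le> e" for e e' i i'
  proof -
    have le: "e' \<le> i'" using that by linarith
    have mn: "e * i' \<le> m * n" using that by (intro mult_le_mono)
    have ee: "e * e' \<le> e * i'" using le by simp
    have low: "i' * l + e * l' \<le> n * l + m * l'" using that by (intro add_mono mult_le_mono) auto
    show ?thesis
    proof (cases "i' \<le> e")
      case True
      have "i' * r = i' * l + i' * l'" using assms(7) by (simp add: distrib_left [symmetric])
      also have "\<dots> \<le> i' * l + e * l'" using True by simp
      finally have "i' * r \<le> n * l + m * l'" using low by linarith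
      moreover have "i' * r = i * i' + i' * i'"
        by (simp add: that(6) [symmetric] algebra_simps)
      ultimately have "i' * i' = 0" and "e * e' = m * n" using eq mn ee by linarith+
      then show ?thesis using le by simp
    next
      case False
      have "e * r = e * l + e * l'" using assms(7) by (simp add: distrib_left [symmetric])
      also have "\<dots> \<le> i' * l + e * l'" using False by simp
      finally have er: "e * r \<le> n * l + m * l'" using low by linarith
      have ii: "i * i' \<le> e * i'" using that by simp
      have "e * i + e * i' \<le> n * l + m * l'" "e * e + e * e' \<le> n * l + m * l'"
        using er that(5,6) by (simp_all add: distrib_left [symmetric])
      then have z: "e * i = 0" and "e * e' = m * n" using eq mn ee ii by linarith+
      show ?thesis
      proof (cases "e = 0")
        case False
        then have "i = 0" using z by simp
        then have "e * e = 0" using eq \<open>e * e + e * e' \<le> _\<close> by simp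
        then show ?thesis using False by simp
      qed (use \<open>e * e' = m * n\<close> in simp)
    qed
  qed
  show ?thesis
  proof (cases "i \<le> e")
    case True
    then show ?thesis using main [of e i e' i'] assms by simp
  next
    case False
    then show ?thesis using main [of i e i' e'] assms by (simp add: add.commute)
  qed
qed

section \<open>Smoothness outside the coordinate lines\<close>

text \<open>Two points \<open>(a, b)\<close>, \<open>(a', b')\<close> of the curve \<open>(u\<^sup>A, u\<^sup>B)\<close>, collinear with the point
  \<open>(1, 1)\<close> by \<open>E1\<close>, at which the line is tangent by \<open>E3\<close> and \<open>E2\<close>; here \<open>\<alpha> = A\<close> and \<open>\<beta> = B\<close>.\<close>

lemma tangent_points_coincide:
  fixes a b a' b' \<alpha> \<beta> :: "'a::field"
  assumes nz: "\<alpha> \<noteq> 0" "\<beta> \<noteq> 0" "\<alpha> \<noteq> \<beta>" "a \<noteq> 0" "b \<noteq> 0"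
    and E1: "(1 - b) * (1 - a') = (1 - a) * (1 - b')"
    and E2: "\<alpha> * a' * (1 - b) = \<beta> * b' * (1 - a)"
    and E3: "\<alpha> * a * (1 - b') = \<beta> * b * (1 - a')"
  shows "a = 1 \<and> b = 1 \<or> a' = 1 \<and> b' = 1 \<or> a = a' \<and> b = b'"
proof -
  \<comment> \<open>(p, q) and (p', q') point from (a, b) and (a', b') to (1, 1); the tangent at (a,
    b) has direction (\<alpha> a, \<beta> b).\<close>
  define p q p' q' where pq: "p = 1 - a" "q = 1 - b" "p' = 1 - a'" "q' = 1 - b'"
  note E = E1 E2 E3
  note E = E [folded pq]
  \<comment> \<open>E3 is tangency at (a, b) along (p', q'). By E1 it holds along (p, q) as well,
    unless p' = q' = 0.\<close>
  have "p' * (\<alpha> * a * q - \<beta> * b * p) = \<alpha> * a * (q * p') - p * (\<beta> * b * p')"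
    by (simp add: algebra_simps)
  also have "\<dots> = 0" unfolding E(1) E(3) [symmetric] by (simp add: algebra_simps)
  finally have 1: "p' * (\<alpha> * a * q - \<beta> * b * p) = 0" .
  have "q' * (\<alpha> * a * q - \<beta> * b * p) = q * (\<alpha> * a * q') - \<beta> * b * (p * q')"
    by (simp add: algebra_simps)
  also have "\<dots> = 0" unfolding E(1) [symmetric] E(3) by (simp add: algebra_simps)
  finally have 2: "q' * (\<alpha> * a * q - \<beta> * b * p) = 0" .
  show ?thesis
  proof (cases "\<alpha> * a * q = \<beta> * b * p")
    case False
    then show ?thesis using 1 2 pq by simp
  next
    case E4: True
    show ?thesis
    proof (cases "p = 0 \<or> q = 0")
      case True
      then show ?thesis using E4 nz pq by auto
    next
      case False
      \<comment> \<open>Both tangents are now parallel to (p, q), so (a, b) and (a', b') are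
        proportional; E1 then leaves a - a' = b - b'.\<close>
      have "(\<alpha> * \<beta> * p * q) * (a * b') = (\<alpha> * a * q) * (\<beta> * b' * p)"
        by (simp add: ac_simps)
      also have "\<dots> = (\<beta> * b * p) * (\<alpha> * a' * q)" unfolding E4 E(2) ..
      also have "\<dots> = (\<alpha> * \<beta> * p * q) * (a' * b)" by (simp add: ac_simps)
      finally have ab: "a * b' = a' * b" using False nz by simp
      have d: "a - a' = b - b'" using E1 ab by (simp add: algebra_simps)
      have "(a - a') * (\<alpha> * q - \<beta> * p) =
          (\<alpha> * a * q - \<alpha> * a' * q) - (a - a') * (\<beta> * p)"
        by (simp add: algebra_simps)
      also have "\<dots> = 0" unfolding E4 E(2) d by (simp add: algebra_simps)
      finally consider "a = a'" | "\<alpha> * q = \<beta> * p" by auto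
      then show ?thesis
      proof cases
        case 1
        then show ?thesis using d by simp
      next
        case 2
        \<comment> \<open>Here the tangency at (a, b) gives a = b, hence p = q and \<alpha> =
          \<beta>, which is excluded.\<close>
        have "(\<alpha> * q) * a = \<beta> * b * p" using E4 by (simp add: ac_simps)
        also have "\<dots> = (\<beta> * p) * b" by (simp add: ac_simps)
        also have "\<dots> = (\<alpha> * q) * b" unfolding 2 ..
        finally have "a = b" using nz False by simp
        then have "\<alpha> * p = \<beta> * p" using 2 pq by simp
        then show ?thesis using nz False by simp
      qed
    qed
  qed
qed

lemma poly_map_poly_eval:
  "poly (map_poly (\<lambda>p. poly p x) f) z = poly (poly f [:z:]) (x :: 'a::comm_ring_1)"
proof (induction f)
  case (pCons c f)
  show ?case
    by (simp add: pCons.IH [symmetric] poly_hom.map_poly_pCons_hom)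
qed simp

text \<open>Monomials are eigenvectors of \<open>x \<partial>/\<partial>x\<close> and \<open>z \<partial>/\<partial>z\<close>; hence the factors \<open>x\<close> and \<open>z\<close> in the
  derivatives of \<open>mono2\<close> below.\<close>

context
  fixes x z :: "'k::field"
begin

definition pv :: "'k poly poly \<Rightarrow> 'k" where "pv h = poly (poly h [:z:]) x"
text \<open>The outer variable is z, so \<open>pderiv\<close> is d/dz, and d/dx is taken after z has
  been specialized. Mixed derivatives are therefore \<open>pv_x\<close> of iterated
  \<open>pderiv\<close>.\<close>

definition pv_x :: "'k poly poly \<Rightarrow> 'k" where "pv_x h = poly (pderiv (poly h [:z:])) x"

lemma pv_mult: "pv (h * k) = pv h * pv k"
  by (simp add: pv_def)

lemma pv_add: "pv (h + k) = pv h + pv k" and pv_diff: "pv (h - k) = pv h - pv k"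
  by (simp_all add: pv_def)

lemma pv_x_mult: "pv_x (h * k) = pv_x h * pv k + pv h * pv_x k"
  by (simp add: pv_x_def pv_def pderiv_mult algebra_simps)

lemma pv_x_add: "pv_x (h + k) = pv_x h + pv_x k" and pv_x_diff: "pv_x (h - k) = pv_x h - pv_x k"
  by (simp_all add: pv_x_def pderiv_add pderiv_diff)

lemmas pv_rules = pv_mult pv_add pv_x_mult pv_x_add pderiv_mult pderiv_add

text \<open>By the Leibniz rule, derivatives of order below r vanish at a common zero of r factors.
  Here and for three and four factors, the derivatives recorded are those read in
  \<open>no_common_zero\<close>.\<close>

lemma order2_product:
  assumes "pv f = 0" "pv g = 0"
  shows "pv_x (f * g) = 0" "pv (pderiv (f * g)) = 0"
  by (simp_all add: pv_rules assms)

lemma order3_product: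
  assumes "pv f = 0" "pv g = 0" "pv h = 0"
  shows "pv_x (pderiv (f * g * h)) = 0" "pv (pderiv (pderiv (f * g * h))) = 0"
  by (simp_all add: pv_rules assms)

lemma order4_product:
  assumes "pv f = 0" "pv g = 0" "pv h = 0" "pv k = 0"
  shows "pv_x (pderiv (pderiv (f * g * h * k))) = 0"
  by (simp add: pv_rules assms)

definition mono2 :: "nat \<Rightarrow> nat \<Rightarrow> 'k poly poly" where "mono2 m n = monom (monom 1 m) n"

lemma mono2_eq: "mono2 m n = [:[:0, 1:]:] ^ m * [:0, 1:] ^ n"
proof -
  have "mono2 m n = [:monom 1 m:] * monom 1 n"
    by (simp add: mono2_def smult_monom)
  also have "[:monom 1 m:] = [:[:0, 1:]:] ^ m"
    by (simp add: monom_altdef poly_const_pow)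
  finally show ?thesis by (simp add: monom_altdef)
qed

lemma pv_mono2: "pv (mono2 m n) = x ^ m * z ^ n"
  by (simp add: pv_def mono2_def poly_monom poly_const_pow)

lemma pderiv_mono2: "pderiv (mono2 m n) = of_nat n * mono2 m (n - 1)"
  by (simp add: mono2_def pderiv_monom of_nat_poly smult_monom)

lemma pv_x_mono2: "x * pv_x (mono2 m n) = of_nat m * x ^ m * z ^ n"
proof -
  have "pv_x (mono2 m n) = of_nat m * x ^ (m - 1) * z ^ n"
    by (simp add: pv_x_def mono2_def poly_monom poly_const_pow pderiv_mult pderiv_monom
      pderiv_pCons pderiv_smult mult.commute)
  then show ?thesis by (cases m) simp_all
qed

lemma pv_of_nat_mult: "pv (of_nat n * h) = of_nat n * pv h"
  by (simp add: pv_def of_nat_poly)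

lemma pv_x_of_nat_mult: "pv_x (of_nat n * h) = of_nat n * pv_x h"
  by (simp add: pv_x_def of_nat_poly pderiv_smult)

lemma pv_z_mono2: "z * pv (pderiv (mono2 m n)) = of_nat n * x ^ m * z ^ n"
proof -
  have "z * pv (pderiv (mono2 m n)) = of_nat n * x ^ m * (z * z ^ (n - 1))"
    by (simp only: pderiv_mono2 pv_of_nat_mult pv_mono2 ac_simps)
  then show ?thesis by (cases n) simp_all
qed

lemma pv_xz_mono2: "x * (z * pv_x (pderiv (mono2 m n))) = of_nat m * of_nat n * x ^ m * z ^ n"
proof -
  have "x * (z * pv_x (pderiv (mono2 m n))) = of_nat n * z * (x * pv_x (mono2 m (n - 1)))"
    by (simp add: pderiv_mono2 pv_x_of_nat_mult)
  also have "\<dots> = of_nat m * of_nat n * x ^ m * z ^ n"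
    unfolding pv_x_mono2 by (cases n) simp_all
  finally show ?thesis .
qed

lemma pderiv2_mono2: "pderiv (pderiv (mono2 m n)) = of_nat n * (of_nat (n - 1) * mono2 m (n - 2))"
  by (simp add: pderiv_mono2 pderiv_mult numeral_2_eq_2)

text \<open>For n < 2, where the subtractions are truncated, the factor n (n - 1) is zero.\<close>

lemma z2_pow: "of_nat n * (of_nat (n - 1) * (z * (z * z ^ (n - 2)))) = of_nat n * (of_nat n - 1) * z ^ n"
proof (cases n)
  case (Suc k)
  then show ?thesis by (cases k) simp_all
qed simp

lemma pv_zz_mono2:
  "z * (z * pv (pderiv (pderiv (mono2 m n)))) = of_nat n * (of_nat n - 1) * x ^ m * z ^ n"
proof -
  have "z * (z * pv (pderiv (pderiv (mono2 m n)))) =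
      x ^ m * (of_nat n * (of_nat (n - 1) * (z * (z * z ^ (n - 2)))))"
    by (simp only: pderiv2_mono2 pv_of_nat_mult pv_mono2 ac_simps)
  then show ?thesis unfolding z2_pow by (simp only: ac_simps)
qed

lemma pv_xzz_mono2:
  "x * (z * (z * pv_x (pderiv (pderiv (mono2 m n))))) =
    of_nat m * (of_nat n * (of_nat n - 1)) * x ^ m * z ^ n"
proof -
  have "x * (z * (z * pv_x (pderiv (pderiv (mono2 m n))))) =
      of_nat n * (of_nat (n - 1) * (z * (z * (x * pv_x (mono2 m (n - 2))))))"
    by (simp only: pderiv2_mono2 pv_x_of_nat_mult ac_simps)
  also have "\<dots> = of_nat m * x ^ m * (of_nat n * (of_nat (n - 1) * (z * (z * z ^ (n - 2)))))"
    unfolding pv_x_mono2 by (simp only: ac_simps)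
  finally show ?thesis unfolding z2_pow by (simp only: ac_simps)
qed

end

section \<open>Factorizations in the affine plane\<close>

lemma no_nonzero_root_imp_monomial:
  fixes r :: "'k::alg_closed_field poly"
  assumes "\<And>x. x \<noteq> 0 \<Longrightarrow> poly r x \<noteq> 0"
  obtains c N where "c \<noteq> 0" "r = Polynomial.smult c ([:0, 1:] ^ N)"
proof -
  have "r \<noteq> 0" using assms [of 1] by auto
  then obtain q where q: "r = [:- 0, 1:] ^ order 0 r * q" "\<not> [:- 0, 1:] dvd q"
    using order_decomp [of r 0] by blast
  have "poly q x \<noteq> 0" for x
  proof (cases "x = 0")
    case True
    then show ?thesis using q(2) by (simp add: poly_eq_0_iff_dvd)
  next
    case False
    then show ?thesis using assms [of x] q(1) by (metis mult_zero_right poly_mult)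
  qed
  then have "degree q = 0" using alg_closed_imp_poly_has_root [of q] by blast
  then obtain c where c: "q = [:c:]" by (metis degree_eq_zeroE)
  have "r = Polynomial.smult c ([:0, 1:] ^ order 0 r)" using q(1) c by simp
  moreover have "c \<noteq> 0" using c \<open>poly q _ \<noteq> 0\<close> [of 0] by auto
  ultimately show thesis by (rule that [rotated])
qed

text \<open>The equation tau = f g is stated with V multiplied out; x is the inner variable and z
  the outer one.\<close>

locale plane_factorization = exponents A B d K
  for A B d :: nat and K :: "'k::alg_closed_field itself" +
  fixes f g :: "'k poly poly"
  assumes fac: "f * g * vandermonde ([:[:0, 1:]:] ^ d) 1 ([:0, 1:] ^ d) =
    gen_vandermonde A B [:[:0, 1:]:] 1 [:0, 1:]"
begin

lemma factors:
  "f * g * ([:[:0, 1:]:] ^ d - 1) * ([:0, 1:] ^ d - [:[:0, 1:]:] ^ d) * ([:0, 1:] ^ d - 1) =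
    mono2 B A - mono2 0 A + mono2 0 B - mono2 A B + mono2 A 0 - mono2 B 0"
  using fac by (simp add: vandermonde_def gen_vandermonde_expand mono2_eq algebra_simps)

text \<open>Besides the two orders due to \<open>f\<close> and \<open>g\<close>, each coincidence
  among 1, x^d and z^d adds an order of vanishing to R. The second derivatives that vanish in this
  way make all three points coincide. There x z^2 times the derivative of R by x, z, z is \<alpha>
  \<beta> (\<alpha> - \<beta>), which would have to vanish too.\<close>

lemma no_common_zero:
  assumes x: "x \<noteq> 0"
  shows "\<not> (poly (map_poly (\<lambda>p. poly p x) f) z = 0 \<and> poly (map_poly (\<lambda>p. poly p x) g) z = 0)"
proof
  assume "poly (map_poly (\<lambda>p. poly p x) f) z = 0 \<and> poly (map_poly (\<lambda>p. poly p x) g) z = 0"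
  then have fg: "pv x z f = 0" "pv x z g = 0"
    by (simp_all add: poly_map_poly_eval pv_def)
  define D1 D2 D3 :: "'k poly poly" where "D1 = [:[:0, 1:]:] ^ d - 1"
    and "D2 = [:0, 1:] ^ d - [:[:0, 1:]:] ^ d" and "D3 = [:0, 1:] ^ d - 1"
  have Deq: "D1 = mono2 d 0 - mono2 0 0" "D2 = mono2 0 d - mono2 d 0" "D3 = mono2 0 d - mono2 0 0"
    by (simp_all add: D1_def D2_def D3_def mono2_eq)
  have pvD: "pv x z D1 = x ^ d - 1" "pv x z D2 = z ^ d - x ^ d" "pv x z D3 = z ^ d - 1"
    unfolding Deq by (simp_all add: pv_diff pv_mono2)
  define R :: "'k poly poly"
    where "R = mono2 B A - mono2 0 A + mono2 0 B - mono2 A B + mono2 A 0 - mono2 B 0"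
  have R: "R = f * g * D1 * D2 * D3"
    unfolding R_def D1_def D2_def D3_def by (rule factors [symmetric])
  let ?\<alpha> = "of_nat A :: 'k" and ?\<beta> = "of_nat B :: 'k"
  \<comment> \<open>The three collinear points are (1, 1), (a, b) and (a', b').\<close>
  define a b a' b' where ab: "a = x ^ A" "b = x ^ B" "a' = z ^ A" "b' = z ^ B"
  have nz: "a \<noteq> 0" "b \<noteq> 0" using x by (simp_all add: ab)
  have R0: "pv x z R = a' * b - a' + b' - b' * a + a - b"
    by (simp add: R_def pv_add pv_diff pv_mono2 ab algebra_simps)
  have Rx: "x * pv_x x z R = ?\<beta> * a' * b - ?\<alpha> * b' * a + ?\<alpha> * a - ?\<beta> * b"
    by (simp add: R_def pv_x_add pv_x_diff distrib_left right_diff_distrib pv_x_mono2 ab ac_simps)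
  have Rz: "z * pv x z (pderiv R) = ?\<alpha> * a' * b - ?\<alpha> * a' + ?\<beta> * b' - ?\<beta> * b' * a"
    by (simp add: R_def pv_add pv_diff pderiv_add pderiv_diff distrib_left right_diff_distrib
      pv_z_mono2 ab ac_simps)
  have Rxz: "x * (z * pv_x x z (pderiv R)) = ?\<alpha> * ?\<beta> * (a' * b - b' * a)"
    by (simp add: R_def pv_x_add pv_x_diff pderiv_add pderiv_diff distrib_left right_diff_distrib
      pv_xz_mono2 ab ac_simps)
  have Rzz: "z * (z * pv x z (pderiv (pderiv R))) =
      ?\<alpha> * (?\<alpha> - 1) * (a' * b - a') + ?\<beta> * (?\<beta> - 1) * (b' - b' * a)"
    by (simp add: R_def pv_add pv_diff pderiv_add pderiv_diff distrib_left right_diff_distrib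
      pv_zz_mono2 ab)
  have Rxzz: "x * (z * (z * pv_x x z (pderiv (pderiv R)))) =
      ?\<beta> * (?\<alpha> * (?\<alpha> - 1)) * a' * b - ?\<alpha> * (?\<beta> * (?\<beta> - 1)) * b' * a"
    by (simp add: R_def pv_x_add pv_x_diff pderiv_add pderiv_diff distrib_left right_diff_distrib
      pv_xzz_mono2 ab)
  have "R = f * (g * D1 * D2 * D3)" by (simp add: R mult.assoc)
  moreover have "pv x z (g * D1 * D2 * D3) = 0" by (simp add: pv_mult fg)
  ultimately have "pv x z R = 0" "pv_x x z R = 0" "pv x z (pderiv R) = 0"
    using order2_product [OF fg(1)] by (simp_all add: pv_mult fg)
  then have E: "a' * b - a' + b' - b' * a + a - b = 0"
      "?\<beta> * a' * b - ?\<alpha> * b' * a + ?\<alpha> * a - ?\<beta> * b = 0"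
      "?\<alpha> * a' * b - ?\<alpha> * a' + ?\<beta> * b' - ?\<beta> * b' * a = 0"
    using R0 Rx Rz by simp_all
  \<comment> \<open>At a coincidence one of the Vandermonde factors vanishes, so \<open>R\<close> vanishes to third order.\<close>
  have third: "pv_x x z (pderiv R) = 0 \<and> pv x z (pderiv (pderiv R)) = 0"
    if "pv x z D1 = 0 \<or> pv x z D2 = 0 \<or> pv x z D3 = 0"
  proof -
    have "R = f * g * (D1 * D2 * D3)" by (simp add: R mult.assoc)
    moreover have "pv x z (D1 * D2 * D3) = 0" using that by (auto simp: pv_mult)
    ultimately show ?thesis using order3_product [OF fg] by simp
  qed
  have diff: "?\<alpha> - ?\<beta> \<noteq> 0" using diff_unit by simp
  show False
  proof (cases "z = 0")
    \<comment> \<open>On z = 0 the operator z d/dz carries no information, but the value and the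
      x-derivative suffice.\<close>
    case True
    then have "a' = 0" "b' = 0" using B_pos B_less_A by (simp_all add: ab)
    then have "a = b" "(?\<alpha> - ?\<beta>) * a = 0" using E by (simp_all add: algebra_simps)
    then show False using diff nz by simp
  next
    case False
    have "a' \<noteq> 0" "b' \<noteq> 0" using False by (simp_all add: ab)
    have "a = 1 \<and> b = 1 \<or> a' = 1 \<and> b' = 1 \<or> a = a' \<and> b = b'"
      by (rule tangent_points_coincide [OF A_unit B_unit diff_unit nz])
        (use E in \<open>simp_all add: algebra_simps\<close>)
    then have all: "a = 1 \<and> b = 1 \<and> a' = 1 \<and> b' = 1"
    proof (elim disjE conjE)
      \<comment> \<open>The mixed derivative gives a' = b', and the x-derivative then gives a' =
        1.\<close>
      assume 1: "a = 1" "b = 1"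
      have "x ^ d = 1" using power_gcd_eq [of x 1] 1 ab by simp
      then have "pv_x x z (pderiv R) = 0" using third pvD by simp
      then have "a' = b'" using Rxz 1 A_unit B_unit by simp
      then have "(?\<alpha> - ?\<beta>) * (1 - a') = 0" using E(2) 1 by (simp add: algebra_simps)
      then show ?thesis using diff 1 \<open>a' = b'\<close> by simp
    next
      assume 1: "a' = 1" "b' = 1"
      have "z ^ d = 1" using power_gcd_eq [of z 1] 1 ab by simp
      then have "pv_x x z (pderiv R) = 0" using third pvD by simp
      then have "b = a" using Rxz 1 A_unit B_unit by simp
      then have "(?\<alpha> - ?\<beta>) * (1 - a) = 0" using E(3) 1 by (simp add: algebra_simps)
      then show ?thesis using diff 1 \<open>b = a\<close> by simp
    next
      \<comment> \<open>The mixed derivative is trivially zero here, so the second z-derivative is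
        used. With the first one it forms a linear system in \<alpha> (a b - a) and \<beta> (b - b
        a) of determinant \<beta> - \<alpha>.\<close>
      assume 1: "a = a'" "b = b'"
      have "z ^ d = x ^ d" using power_gcd_eq [of z x] 1 ab x by simp
      then have "pv x z (pderiv (pderiv R)) = 0" using third pvD by simp
      then have zz: "?\<alpha> * (?\<alpha> - 1) * (a * b - a) + ?\<beta> * (?\<beta> - 1) * (b - b * a) = 0"
        using Rzz 1 by simp
      have 2: "?\<alpha> * (a * b - a) + ?\<beta> * (b - b * a) = 0"
        using E(3) 1 by (simp add: algebra_simps)
      have "(?\<alpha> - ?\<beta>) * (?\<beta> * (b - b * a)) =
          (?\<alpha> - 1) * (?\<alpha> * (a * b - a) + ?\<beta> * (b - b * a)) -
          (?\<alpha> * (?\<alpha> - 1) * (a * b - a) + ?\<beta> * (?\<beta> - 1) * (b - b * a))"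
        by (simp add: algebra_simps)
      also have "\<dots> = 0" unfolding zz 2 by simp
      finally have "b - b * a = 0" using diff B_unit by (metis mult_eq_0_iff)
      then have "b * (1 - a) = 0" by (simp add: algebra_simps)
      then have "a = 1" using nz by simp
      moreover from this have "b = 1" using 2 A_unit by simp
      ultimately show ?thesis using 1 by simp
    qed
    then have "x ^ d = 1" "z ^ d = 1"
      using power_gcd_eq [of x 1] power_gcd_eq [of z 1] ab by simp_all
    then have D: "pv x z D1 = 0" "pv x z D2 = 0" "pv x z D3 = 0" using pvD by simp_all
    have "R = (f * g) * D1 * D2 * D3" by (simp add: R)
    moreover have "pv x z (f * g) = 0" by (simp add: pv_mult fg)
    ultimately have "pv_x x z (pderiv (pderiv R)) = 0"
      using order4_product [OF _ D] by simp
    then have "?\<alpha> * ?\<beta> * (?\<alpha> - ?\<beta>) = 0"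
      using Rxzz all by (auto simp: algebra_simps)
    then show False using diff A_unit B_unit by simp
  qed
qed

text \<open>As polynomials in z, R has degree A and leading coefficient x^B - 1, while V has degree
  2d and leading coefficient x^d - 1.\<close>

lemma degree_and_lead_coeff:
  "degree f + degree g + 2 * d = A"
  "lead_coeff f * lead_coeff g * ([:0, 1:] ^ d - 1) = [:0, 1:] ^ B - 1"
  "f \<noteq> 0" "g \<noteq> 0"
proof -
  have lin: "degree ([:0, 1:] ^ n - [:c:] :: 'k poly poly) = n \<and>
      lead_coeff ([:0, 1:] ^ n - [:c:] :: 'k poly poly) = 1" if "0 < n" for n c
  proof -
    have "degree ([:0, 1:] ^ n - [:c:] :: 'k poly poly) = degree ([:0, 1:] ^ n :: 'k poly poly)"
      unfolding diff_conv_add_uminus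
      by (rule degree_add_eq_left) (use that in \<open>simp add: degree_power_eq\<close>)
    then have "degree ([:0, 1:] ^ n - [:c:] :: 'k poly poly) = n"
      by (simp add: degree_power_eq)
    moreover have "coeff ([:0, 1:] ^ n - [:c:] :: 'k poly poly) n = 1"
      using that by (simp add: coeff_linear_power coeff_pCons split: nat.split)
    ultimately show ?thesis by simp
  qed
  define x1 :: "'k poly" where "x1 = [:0, 1:]"
  have pc: "[:x1:] ^ n = [:x1 ^ n:]" for n by (rule poly_const_pow)
  define L :: "'k poly poly" where "L = [:x1 ^ d - 1:] * ([:0, 1:] ^ d - [:x1 ^ d:]) * ([:0, 1:] ^ d - [:1:])"
  have ne: "x1 ^ n - 1 \<noteq> 0" if "0 < n" for n
  proof
    assume "x1 ^ n - 1 = 0"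
    then have "degree (x1 ^ n) = 0" by simp
    then show False using that by (simp add: x1_def degree_power_eq)
  qed
  have L0: "[:0, 1:] ^ d - [:c:] \<noteq> (0 :: 'k poly poly)" for c
    using lin [OF d_pos, of c] by (metis leading_coeff_0_iff zero_neq_one)
  have degL: "degree L = 2 * d"
    unfolding L_def using ne [OF d_pos] L0 lin [OF d_pos]
    by (subst degree_mult_eq; (subst degree_mult_eq)?) auto
  have lcL: "lead_coeff L = x1 ^ d - 1"
    by (simp only: L_def lead_coeff_mult lin [OF d_pos, THEN conjunct2] mult_1_right) simp
  have fgL: "f * g * L = monom (x1 ^ B - 1) A + (monom (1 - x1 ^ A) B + [:x1 ^ A - x1 ^ B:])"
  proof -
    have "f * g * L = mono2 B A - mono2 0 A + mono2 0 B - mono2 A B + mono2 A 0 - mono2 B 0"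
      using factors by (simp add: L_def x1_def [symmetric] pc one_pCons [symmetric] mult.assoc
          flip: pCons_one)
    moreover have "mono2 m n = monom (x1 ^ m) n" for m n
      by (simp add: mono2_def x1_def monom_altdef [of "1 :: 'k"])
    ultimately show ?thesis by (simp add: monom_0 flip: diff_monom)
  qed
  have low: "degree (monom (1 - x1 ^ A) B + [:x1 ^ A - x1 ^ B:]) < A"
    by (rule degree_add_less) (use B_less_A degree_monom_le [of "1 - x1 ^ A" B] in auto)
  have "degree (f * g * L) = A"
    unfolding fgL using low ne [OF B_pos] by (subst degree_add_eq_left) (auto simp: degree_monom_eq)
  moreover have "coeff (f * g * L) A = x1 ^ B - 1"
    unfolding fgL using coeff_eq_0 [OF low] by simp
  ultimately have lc: "lead_coeff (f * g * L) = x1 ^ B - 1" and deg: "degree (f * g * L) = A"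
    by simp_all
  have nz: "f * g * L \<noteq> 0" using lc ne [OF B_pos] by auto
  then show "f \<noteq> 0" "g \<noteq> 0" by auto
  then show "degree f + degree g + 2 * d = A"
    using deg nz degL by (simp add: degree_mult_eq)
  show "lead_coeff f * lead_coeff g * ([:0, 1:] ^ d - 1) = [:0, 1:] ^ B - 1"
    using lc unfolding lead_coeff_mult lcL x1_def .
qed

end

section \<open>Intersections over x = 0 and x = infinity\<close>

lemma comm_ring_hom_fps_to_fls: "comm_ring_hom (fps_to_fls :: 'a::comm_ring_1 fps \<Rightarrow> 'a fls)"
  by unfold_locales (simp_all add: fls_times_fps_to_fls)

lemma gen_vandermonde_swap: "gen_vandermonde A B y x z = - gen_vandermonde A B x y z"
  by (simp add: gen_vandermonde_expand algebra_simps)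

lemma vandermonde_swap: "vandermonde y x z = - vandermonde x y z"
  by (simp add: vandermonde_def algebra_simps)

lemma gen_vandermonde_scale:
  "gen_vandermonde A B (x * c) (y * c) (z * c) = gen_vandermonde A B x y z * c ^ (A + B)"
  by (simp add: gen_vandermonde_expand power_mult_distrib power_add algebra_simps)

lemma vandermonde_scale: "vandermonde (x * c) (y * c) (z * c) = vandermonde x y z * c ^ 3"
  by (simp add: vandermonde_def power3_eq_cube algebra_simps)

context plane_factorization
begin

lemma factors_eval:
  assumes "comm_ring_hom h" "h [:0, 1:] = a"
  shows "poly (map_poly h f) w * poly (map_poly h g) w * vandermonde (a ^ d) 1 (w ^ d) =
    gen_vandermonde A B a 1 w"
proof -
  interpret h: comm_ring_hom h by fact
  define H where "H p = poly (map_poly h p) w" for p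
  have H: "comm_ring_hom H"
    unfolding H_def by (rule comm_ring_hom_eval_poly [OF assms(1)])
  interpret H: comm_ring_hom H by (rule H)
  have "H [:[:0, 1:]:] = a" "H [:0, 1:] = w"
    using assms(2) by (simp_all add: H_def h.map_poly_pCons_hom)
  then show ?thesis
    using arg_cong [OF fac, of H]
    by (simp add: H.hom_mult hom_vandermonde [OF H] hom_gen_vandermonde [OF H] H.hom_power)
      (simp add: H_def)
qed

abbreviation (input) S where "S \<equiv> sylvester_det (degree f) (degree g) f g"

lemma lead_coeffs_eval:
  "poly (lead_coeff f) x * poly (lead_coeff g) x * (x ^ d - 1) = x ^ B - 1"
  using arg_cong [OF degree_and_lead_coeff(2), of "\<lambda>p. poly p x"] by simp

text \<open>A common root would be a double root of x^B - 1, impossible as B is nonzero in the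
  field. So over each x \<noteq> 0 one of \<open>f\<close> and \<open>g\<close> keeps its degree, as
  \<open>sylvester_det_nonzero\<close> demands.\<close>

lemma lead_coeffs_no_common_root:
  assumes "x \<noteq> 0"
  shows "poly (lead_coeff f) x \<noteq> 0 \<or> poly (lead_coeff g) x \<noteq> 0"
proof (rule ccontr)
  assume *: "\<not> ?thesis"
  have "poly (pderiv (lead_coeff f * lead_coeff g * ([:0, 1:] ^ d - 1))) x = 0"
    using * by (simp add: pderiv_mult)
  moreover have "x * poly (pderiv ([:0, 1:] ^ B - 1)) x = of_nat B * x ^ B"
  proof -
    have "[:0, 1:] ^ B = (monom 1 B :: 'k poly)" by (simp add: monom_altdef)
    then show ?thesis
      using B_pos by (cases B) (simp_all add: pderiv_diff pderiv_monom poly_monom)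
  qed
  ultimately have "of_nat B * x ^ B = 0"
    unfolding degree_and_lead_coeff(2) by simp
  then show False using B_unit assms by simp
qed

lemma degree_map_poly_eval:
  fixes h :: "'k poly poly"
  assumes "poly (lead_coeff h) x \<noteq> 0"
  shows "degree (map_poly (\<lambda>p. poly p x) h) = degree h"
  by (intro antisym degree_map_poly_le le_degree) (use assms in \<open>simp add: coeff_map_poly\<close>)

lemma S_eval_nonzero:
  assumes "x \<noteq> 0"
  shows "poly S x \<noteq> 0"
proof -
  let ?h = "\<lambda>p. poly p x"
  have "comm_ring_hom ?h" by unfold_locales auto
  then have "poly S x = sylvester_det (degree f) (degree g) (map_poly ?h f) (map_poly ?h g)"
    by (rule sylvester_det_hom)
  also have "\<dots> \<noteq> 0"
  proof (rule sylvester_det_nonzero)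
    have "map_poly ?h p \<noteq> 0 \<and> degree (map_poly ?h p) = degree p"
      if "poly (lead_coeff p) x \<noteq> 0" for p :: "'k poly poly"
    proof -
      have "coeff (map_poly ?h p) (degree p) \<noteq> 0" using that by (simp add: coeff_map_poly)
      then have "map_poly ?h p \<noteq> 0" by (metis coeff_0)
      then show ?thesis using degree_map_poly_eval [OF that] by blast
    qed
    then show "map_poly ?h f \<noteq> 0 \<and> degree (map_poly ?h f) = degree f \<or>
        map_poly ?h g \<noteq> 0 \<and> degree (map_poly ?h g) = degree g"
      using lead_coeffs_no_common_root [OF assms] by blast
  qed (use no_common_zero [OF assms] in \<open>auto intro: degree_map_poly_le\<close>)
  finally show ?thesis .
qed

text \<open>B and A - B are positive multiples of d, and both equal d only if A = 2B. Hence the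
  degree A - 2d of tau in z is positive.\<close>

lemma A_ge: "2 * d < A"
proof -
  obtain i where i: "B = d * i" using d_dvd_B by blast
  obtain j where j: "A - B = d * j" using d_dvd_diff by blast
  have "0 < i" "0 < j" using i j B_pos B_less_A by (auto intro: Nat.gr0I)
  moreover have "i \<noteq> 1 \<or> j \<noteq> 1" using i j A_neq B_less_A by auto
  ultimately have "3 \<le> i + j" by linarith
  then have "d * 3 \<le> d * (i + j)" by simp
  also have "\<dots> = A" using i j B_less_A by (simp add: distrib_left)
  finally show ?thesis using d_pos by linarith
qed

lemma degree_f_or_g_0: "degree f = 0 \<or> degree g = 0"
proof -
  obtain \<Omega>0 \<Omega>1 :: "'k fps set"
    where fin: "finite \<Omega>0" "finite \<Omega>1" and card: "card \<Omega>0 = A - B - d" "card \<Omega>1 = B - d"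
      and disj: "\<Omega>0 \<inter> \<Omega>1 = {}"
      and root: "\<And>w. w \<in> \<Omega>0 \<union> \<Omega>1 \<Longrightarrow> gen_vandermonde A B fps_X 1 w = 0"
      and nz: "\<And>w. w \<in> \<Omega>0 \<union> \<Omega>1 \<Longrightarrow> vandermonde (fps_X ^ d) 1 (w ^ d) \<noteq> 0"
      and val: "\<And>v w. v \<in> \<Omega>0 \<union> \<Omega>1 \<Longrightarrow> w \<in> \<Omega>0 \<union> \<Omega>1 \<Longrightarrow> v \<noteq> w \<Longrightarrow>
        subdegree (v - w) = (if v \<in> \<Omega>1 \<and> w \<in> \<Omega>1 then 1 else 0)"
    using branches by blast
  define \<Omega> where "\<Omega> = \<Omega>0 \<union> \<Omega>1"
  note nzfg = degree_and_lead_coeff(3,4)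
  have "d \<le> B" "d \<le> A - B" using d_dvd_B d_dvd_diff B_pos B_less_A by (simp_all add: dvd_imp_le)
  moreover have "card \<Omega> = (A - B - d) + (B - d)"
    using card_Un_disjoint [OF fin disj] card by (simp only: \<Omega>_def)
  ultimately have card_\<Omega>: "card \<Omega> = degree f + degree g"
    using degree_and_lead_coeff(1) B_less_A by linarith
  \<comment> \<open>A single exponent N now gives the order of \<open>S\<close> at 0 and, with
    opposite sign, at infinity.\<close>
  obtain c N where c: "c \<noteq> 0" and S: "S = Polynomial.smult c ([:0, 1:] ^ N)"
    using no_nonzero_root_imp_monomial [of S] S_eval_nonzero by blast
  have inj: "inj fps_to_fls" by (auto intro: injI)
  have root_fls: "gen_vandermonde A B fls_X 1 (fps_to_fls w) = 0"
    and nz_fls: "vandermonde (fls_X ^ d) 1 (fps_to_fls w ^ d) \<noteq> 0" if "w \<in> \<Omega>" for w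
  proof -
    have "gen_vandermonde A B fls_X 1 (fps_to_fls w) = fps_to_fls (gen_vandermonde A B fps_X 1 w)"
      by (simp add: hom_gen_vandermonde [OF comm_ring_hom_fps_to_fls])
    then show "gen_vandermonde A B fls_X 1 (fps_to_fls w) = 0"
      using root that by (simp add: \<Omega>_def)
    have "vandermonde (fls_X ^ d) 1 (fps_to_fls w ^ d) =
        fps_to_fls (vandermonde (fps_X ^ d) 1 (w ^ d))"
      by (simp add: hom_vandermonde [OF comm_ring_hom_fps_to_fls] fps_to_fls_power)
    then show "vandermonde (fls_X ^ d) 1 (fps_to_fls w ^ d) \<noteq> 0"
      using nz that by (simp add: \<Omega>_def)
  qed
  have sub_fls: "fls_subdegree (fps_to_fls v - fps_to_fls w) =
      (if fps_to_fls v \<in> fps_to_fls ` \<Omega>1 \<and> fps_to_fls w \<in> fps_to_fls ` \<Omega>1 then 1 else 0)"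
    if "v \<in> \<Omega>" "w \<in> \<Omega>" "v \<noteq> w" for v w
    using val [of v w] that
    by (simp add: \<Omega>_def inj_image_mem_iff [OF inj] fls_subdegree_fls_to_fps flip: fps_to_fls_minus)
  have ev0: "poly (map_poly (fls_eval a) f) w * poly (map_poly (fls_eval a) g) w = 0"
    if "gen_vandermonde A B a 1 w = 0" "vandermonde (a ^ d) 1 (w ^ d) \<noteq> 0" for a w
    using factors_eval [OF comm_ring_hom_fls_eval, of a a w] that by (simp add: fls_eval_pCons)

  have "\<exists>e e'. e \<le> degree f \<and> e' \<le> degree g \<and> e + e' = B - d \<and> N = e * e'"
  proof -
    obtain e e' where e: "e \<le> degree f" "e' \<le> degree g" "e + e' = card (fps_to_fls ` \<Omega>1)"
      "fls_subdegree (fls_eval fls_X S) =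
        int (degree g) * fls_subdegree (fls_eval fls_X (lead_coeff f)) +
        int (degree f) * fls_subdegree (fls_eval fls_X (lead_coeff g)) +
        int (e * e') - 0 * int (degree f * degree g)"
    proof (rule subdegree_sylvester_det [OF nzfg, where \<Omega> = "fps_to_fls ` \<Omega>" and a = fls_X
          and \<Gamma> = "fps_to_fls ` \<Omega>1" and s = 0])
      show "card (fps_to_fls ` \<Omega>) = degree f + degree g"
        using card_\<Omega> by (simp add: card_image inj_on_subset [OF inj])
      show "poly (map_poly (fls_eval fls_X) f) w * poly (map_poly (fls_eval fls_X) g) w = 0"
        if "w \<in> fps_to_fls ` \<Omega>" for w
        using that root_fls nz_fls ev0 by blast
    qed (use fin sub_fls in \<open>auto simp: \<Omega>_def fls_eval_X_nonzero\<close>)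
    \<comment> \<open>The leading coefficients are units at x = 0, so only differences of roots
      contribute to the order of \<open>S\<close>.\<close>
    have "poly (lead_coeff f) 0 * poly (lead_coeff g) 0 = 1"
      using lead_coeffs_eval [of 0] d_pos B_pos by (simp add: power_0_left)
    then have "poly (lead_coeff f) 0 \<noteq> 0" "poly (lead_coeff g) 0 \<noteq> 0" by auto
    then have "fls_subdegree (fls_eval fls_X S) = int (e * e')"
      using e(4) by (simp add: fls_eval_X_subdegree_0)
    moreover have "fls_subdegree (fls_eval fls_X S) = int N"
      unfolding S fls_eval_monomial using c by simp
    ultimately have "int N = int (e * e')" by simp
    then have "N = e * e'" by (simp only: of_nat_eq_iff)
    moreover have "card (fps_to_fls ` \<Omega>1) = B - d"
      using card by (simp add: card_image inj_on_subset [OF inj])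
    ultimately show ?thesis using e by auto
  qed
  then obtain e e' where e: "e \<le> degree f" "e' \<le> degree g" "e + e' = B - d" "N = e * e'" by blast

  define l l' where "l = degree (lead_coeff f)" and "l' = degree (lead_coeff g)"
  \<comment> \<open>The leading coefficients multiply to (x^B - 1) / (x^d - 1); this is the branch
    count at [0:0:1].\<close>
  have l: "l + l' = B - d"
  proof -
    have deg: "degree ([:0, 1:] ^ n - 1 :: 'k poly) = n" if "0 < n" for n
      unfolding diff_conv_add_uminus
      by (subst degree_add_eq_left) (use that in \<open>simp_all add: degree_power_eq\<close>)
    have "[:0, 1:] ^ d - 1 \<noteq> (0 :: 'k poly)" using deg [OF d_pos] d_pos by auto
    then have "degree (lead_coeff f * lead_coeff g * ([:0, 1:] ^ d - 1)) = l + l' + d"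
      using nzfg deg [OF d_pos] by (simp add: degree_mult_eq l_def l'_def)
    then show ?thesis unfolding degree_and_lead_coeff(2) deg [OF B_pos] by simp
  qed

  have "\<exists>i i'. i \<le> degree f \<and> i' \<le> degree g \<and> i + i' = B - d \<and>
      N + i * i' = degree g * l + degree f * l' + degree f * degree g"
  proof -
    define \<phi> where "\<phi> w = fps_to_fls w * (fls_X_inv :: 'k fls)" for w
    have inj_\<phi>: "inj \<phi>" unfolding \<phi>_def using inj by (auto intro!: injI)
    have XX: "fls_X * fls_X_inv = (1 :: 'k fls)" by (simp add: fls_X_times_conv_shift fls_eq_iff)
    have root_inf: "gen_vandermonde A B fls_X_inv 1 (\<phi> w) = 0"
      and nz_inf: "vandermonde (fls_X_inv ^ d) 1 (\<phi> w ^ d) \<noteq> 0" if "w \<in> \<Omega>" for w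
    proof -
      \<comment> \<open>Scaling (1/x, 1, w/x) by x gives (1, x, w), and exchanging the first two
        arguments only changes the sign. Thus the branches at x = 0 also yield the roots at
        infinity.\<close>
      have "gen_vandermonde A B fls_X_inv 1 (\<phi> w) =
          gen_vandermonde A B 1 fls_X (fps_to_fls w) * fls_X_inv ^ (A + B)"
        unfolding gen_vandermonde_scale [symmetric] XX by (simp add: \<phi>_def)
      then show "gen_vandermonde A B fls_X_inv 1 (\<phi> w) = 0"
        using root_fls [OF that] gen_vandermonde_swap [of A B 1 fls_X "fps_to_fls w"] by simp
      have "vandermonde (fls_X_inv ^ d) 1 (\<phi> w ^ d) =
          vandermonde 1 (fls_X ^ d) (fps_to_fls w ^ d) * (fls_X_inv ^ d) ^ 3"
        unfolding vandermonde_scale [symmetric] by (simp add: \<phi>_def XX flip: power_mult_distrib)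
      then show "vandermonde (fls_X_inv ^ d) 1 (\<phi> w ^ d) \<noteq> 0"
        using nz_fls [OF that] vandermonde_swap [of 1 "fls_X ^ d" "fps_to_fls w ^ d"] by simp
    qed
    have sub_inf: "fls_subdegree (\<phi> v - \<phi> w) = (if \<phi> v \<in> \<phi> ` \<Omega>1 \<and> \<phi> w \<in> \<phi> ` \<Omega>1 then 1 else 0) - 1"
      if "v \<in> \<Omega>" "w \<in> \<Omega>" "\<phi> v \<noteq> \<phi> w" for v w
    proof -
      have "v \<noteq> w" using that by auto
      then have "fps_to_fls v - fps_to_fls w \<noteq> 0" by simp
      then have "fls_subdegree (\<phi> v - \<phi> w) = fls_subdegree (fps_to_fls v - fps_to_fls w) - 1"
        unfolding \<phi>_def by (simp flip: left_diff_distrib)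
      then show ?thesis
        using sub_fls [OF that(1,2) \<open>v \<noteq> w\<close>]
        by (simp add: inj_image_mem_iff [OF inj] inj_image_mem_iff [OF inj_\<phi>])
    qed
    obtain i i' where i: "i \<le> degree f" "i' \<le> degree g" "i + i' = card (\<phi> ` \<Omega>1)"
      "fls_subdegree (fls_eval fls_X_inv S) =
        int (degree g) * fls_subdegree (fls_eval fls_X_inv (lead_coeff f)) +
        int (degree f) * fls_subdegree (fls_eval fls_X_inv (lead_coeff g)) +
        int (i * i') - 1 * int (degree f * degree g)"
    proof (rule subdegree_sylvester_det [OF nzfg, where \<Omega> = "\<phi> ` \<Omega>" and a = fls_X_inv
          and \<Gamma> = "\<phi> ` \<Omega>1" and s = 1])
      show "card (\<phi> ` \<Omega>) = degree f + degree g"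
        using card_\<Omega> by (simp add: card_image inj_on_subset [OF inj_\<phi>])
      show "fls_subdegree (v - w) = (if v \<in> \<phi> ` \<Omega>1 \<and> w \<in> \<phi> ` \<Omega>1 then 1 else 0) - 1"
        if "v \<in> \<phi> ` \<Omega>" "w \<in> \<phi> ` \<Omega>" "v \<noteq> w" for v w
        using that sub_inf by blast
      show "poly (map_poly (fls_eval fls_X_inv) f) w * poly (map_poly (fls_eval fls_X_inv) g) w = 0"
        if "w \<in> \<phi> ` \<Omega>" for w
        using that root_inf nz_inf ev0 by blast
      show "fls_eval fls_X_inv q \<noteq> 0" if "q \<noteq> 0" for q :: "'k poly"
        using fls_eval_X_inv [OF that] by simp
    qed (use fin in \<open>auto simp: \<Omega>_def\<close>)
    have "fls_subdegree (fls_eval fls_X_inv S) = - int N"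
      unfolding S fls_eval_monomial using c by simp
    moreover have "fls_subdegree (fls_eval fls_X_inv (lead_coeff f)) = - int l"
      "fls_subdegree (fls_eval fls_X_inv (lead_coeff g)) = - int l'"
      using fls_eval_X_inv [of "lead_coeff f"] fls_eval_X_inv [of "lead_coeff g"] nzfg
      by (simp_all add: l_def l'_def)
    ultimately have "- int N = - (int (degree g) * int l) - int (degree f) * int l' + int (i * i') -
        int (degree f * degree g)"
      using i(4) by simp
    then have "int (N + i * i') = int (degree g * l + degree f * l' + degree f * degree g)"
      by simp
    then have "N + i * i' = degree g * l + degree f * l' + degree f * degree g"
      by (simp only: of_nat_eq_iff)
    moreover have "card (\<phi> ` \<Omega>1) = B - d"
      using card by (simp add: card_image inj_on_subset [OF inj_\<phi>])
    ultimately show ?thesis using i by auto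
  qed
  then obtain i i' where i: "i \<le> degree f" "i' \<le> degree g" "i + i' = B - d"
    "N + i * i' = degree g * l + degree f * l' + degree f * degree g" by blast
  show ?thesis
    by (rule bezout_count_trivial [OF e(1) i(1) e(2) i(2) e(3) i(3) l]) (use i(4) e(4) in simp)
qed

text \<open>Here \<open>f\<close> is a polynomial in x alone. Over a root x \<noteq> 0 of it,
  \<open>g\<close> keeps its positive degree in z and has a zero, which would be common to both. The
  root x = 0 is excluded by the leading coefficients.\<close>

lemma f_const_if_degree_0:
  assumes "degree f = 0"
  shows "\<exists>c. f = [:[:c:]:] \<and> c \<noteq> 0"
proof -
  obtain q where q: "f = [:q:]" using assms by (metis degree_eq_zeroE)
  have "poly q x \<noteq> 0" for x
  proof
    assume x: "poly q x = 0"
    then have lf: "poly (lead_coeff f) x = 0" by (simp add: q)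
    show False
    proof (cases "x = 0")
      case True
      then show False using lead_coeffs_eval [of 0] lf d_pos B_pos by (simp add: power_0_left)
    next
      case False
      let ?g = "map_poly (\<lambda>p. poly p x) g"
      have "poly (lead_coeff g) x \<noteq> 0" using lead_coeffs_no_common_root [OF False] lf by simp
      then have "degree ?g = degree g" by (rule degree_map_poly_eval)
      moreover have "0 < degree g" using degree_and_lead_coeff(1) A_ge assms by linarith
      ultimately obtain z where "poly ?g z = 0"
        using alg_closed_imp_poly_has_root [of ?g] by auto
      moreover have "map_poly (\<lambda>p. poly p x) f = 0" using x by (simp add: q poly_hom.map_poly_pCons_hom)
      ultimately show False using no_common_zero [OF False, of z] by simp
    qed
  qed
  then have "degree q = 0" using alg_closed_imp_poly_has_root [of q] by blast
  then obtain c where "q = [:c:]" by (metis degree_eq_zeroE)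
  with q show ?thesis using degree_and_lead_coeff(3) by auto
qed

lemma f_or_g_const: "\<exists>c. c \<noteq> 0 \<and> (f = [:[:c:]:] \<or> g = [:[:c:]:])"
proof -
  interpret swap: plane_factorization A B d K g f
    by unfold_locales (use fac in \<open>simp add: mult.commute\<close>)
  show ?thesis
    using degree_f_or_g_0 f_const_if_degree_0 swap.f_const_if_degree_0 by blast
qed

end

section \<open>Homogeneous factorizations in three variables\<close>

definition const3 :: "'k \<Rightarrow> 'k::comm_ring_1 poly poly poly" where
  "const3 c = [:[:[:c:]:]:]"

definition eval3 :: "('k::comm_ring_1 \<Rightarrow> 'r::comm_ring_1) \<Rightarrow> 'r \<Rightarrow> 'r \<Rightarrow> 'r \<Rightarrow> 'k poly poly poly \<Rightarrow> 'r"
  where "eval3 h x y z F =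
    poly (map_poly (\<lambda>q. poly (map_poly (\<lambda>p. poly (map_poly h p) x) q) y) F) z"

lemma comm_ring_hom_const3: "comm_ring_hom const3"
  by unfold_locales (simp_all add: const3_def one_pCons)

lemma comm_ring_hom_eval3: "comm_ring_hom h \<Longrightarrow> comm_ring_hom (eval3 h x y z)"
  unfolding eval3_def by (intro comm_ring_hom_eval_poly)

lemma eval3_simps:
  assumes "comm_ring_hom h"
  shows "eval3 h x y z (const3 c) = h c" "eval3 h x y z varX = x" "eval3 h x y z varY = y"
    "eval3 h x y z varZ = z"
proof -
  interpret h: comm_ring_hom h by fact
  interpret h1: comm_ring_hom "\<lambda>p. poly (map_poly h p) x"
    by (rule comm_ring_hom_eval_poly [OF assms])
  interpret h2: comm_ring_hom "\<lambda>q. poly (map_poly (\<lambda>p. poly (map_poly h p) x) q) y"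
    by (rule comm_ring_hom_eval_poly) (rule h1.comm_ring_hom_axioms)
  show "eval3 h x y z (const3 c) = h c" "eval3 h x y z varX = x" "eval3 h x y z varY = y"
    "eval3 h x y z varZ = z"
    by (simp_all add: eval3_def const3_def varX_def varY_def varZ_def
      h.map_poly_pCons_hom h1.map_poly_pCons_hom h2.map_poly_pCons_hom)
qed

lemma hom3_eqI:
  fixes \<phi> \<psi> :: "'k::comm_ring_1 poly poly poly \<Rightarrow> 'r::comm_ring_1"
  assumes "comm_ring_hom \<phi>" "comm_ring_hom \<psi>" and c: "\<And>c. \<phi> (const3 c) = \<psi> (const3 c)"
    and X: "\<phi> varX = \<psi> varX" and Y: "\<phi> varY = \<psi> varY" and Z: "\<phi> varZ = \<psi> varZ"
  shows "\<phi> F = \<psi> F"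
proof -
  interpret \<phi>: comm_ring_hom \<phi> by fact
  interpret \<psi>: comm_ring_hom \<psi> by fact
  have 1: "\<phi> [:[:p:]:] = \<psi> [:[:p:]:]" for p
  proof (induction p)
    case (pCons a p)
    have "[:[:pCons a p:]:] = const3 a + varX * [:[:p:]:]" by (simp add: const3_def varX_def)
    then show ?case by (simp only: \<phi>.hom_add \<psi>.hom_add \<phi>.hom_mult \<psi>.hom_mult c X pCons.IH)
  qed simp
  have 2: "\<phi> [:q:] = \<psi> [:q:]" for q
  proof (induction q)
    case (pCons p q)
    have "[:pCons p q:] = [:[:p:]:] + varY * [:q:]" by (simp add: varY_def)
    then show ?case by (simp only: \<phi>.hom_add \<psi>.hom_add \<phi>.hom_mult \<psi>.hom_mult 1 Y pCons.IH)
  qed simp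
  show ?thesis
  proof (induction F)
    case (pCons q F)
    have "pCons q F = [:q:] + varZ * F" by (simp add: varZ_def)
    then show ?case by (simp only: \<phi>.hom_add \<psi>.hom_add \<phi>.hom_mult \<psi>.hom_mult 2 Z pCons.IH)
  qed simp
qed

text \<open>One of the two constant coefficients vanishes, so a factor X splits off. After
  \<open>homogenize\<close>, this says that factors of homogeneous polynomials are
  homogeneous.\<close>

lemma factor_of_monom:
  fixes p q :: "'a::idom poly"
  assumes "p * q = monom a n" "a \<noteq> 0"
  shows "\<exists>b m. p = monom b m"
  using assms(1)
proof (induction n arbitrary: p q)
  case 0
  have nz: "p \<noteq> 0" "q \<noteq> 0" using 0 assms(2) by (auto simp: monom_0)
  then have "degree p = 0"
    using arg_cong [OF 0, of degree] by (simp add: degree_mult_eq degree_monom_eq monom_0)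
  then show ?case by (metis degree_eq_zeroE monom_0)
next
  case (Suc n)
  have "coeff p 0 * coeff q 0 = 0"
    using arg_cong [OF Suc.prems, of "\<lambda>r. coeff r 0"] by (simp add: coeff_mult)
  then consider "coeff p 0 = 0" | "coeff q 0 = 0" by auto
  then show ?case
  proof cases
    case 1
    then obtain p' where p': "p = pCons 0 p'" by (metis coeff_pCons_0 pCons_cases)
    then have "p' * q = monom a n" using Suc.prems by (simp add: monom_Suc)
    then show ?thesis using Suc.IH p' by (metis monom_Suc)
  next
    case 2
    then obtain q' where q': "q = pCons 0 q'" by (metis coeff_pCons_0 pCons_cases)
    then have "p * q' = monom a n" using Suc.prems by (simp add: monom_Suc)
    then show ?thesis by (rule Suc.IH)
  qed
qed

text \<open>The substitution \<open>X \<mapsto> xy, Y \<mapsto> y, Z \<mapsto> zy\<close> into \<open>k[x][z][y]\<close>, which turns the grading by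
  the total degree into the degree in the outermost variable.\<close>

definition homogenize :: "'k::field poly poly poly \<Rightarrow> 'k poly poly poly" where
  "homogenize = eval3 const3 (varX * varZ) varZ (varY * varZ)"

text \<open>This puts Y = 1: the coefficients of the powers of Z are polynomials in Y over
  k[X].\<close>

definition dehomogenize :: "'k::field poly poly poly \<Rightarrow> 'k poly poly" where
  "dehomogenize = map_poly (\<lambda>q. poly q 1)"

lemma comm_ring_hom_homogenize: "comm_ring_hom homogenize"
  unfolding homogenize_def by (rule comm_ring_hom_eval3 [OF comm_ring_hom_const3])

lemma comm_ring_hom_map_poly_eval:
  "comm_ring_hom (map_poly (\<lambda>q. poly q (a :: 'a::comm_ring_1)))"
proof -
  interpret comm_ring_hom "\<lambda>q. poly q a" by unfold_locales auto
  interpret P: map_poly_comm_ring_hom "\<lambda>q. poly q a" ..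
  show ?thesis by (rule P.comm_ring_hom_axioms)
qed

lemma comm_ring_hom_dehomogenize: "comm_ring_hom dehomogenize"
  unfolding dehomogenize_def by (rule comm_ring_hom_map_poly_eval)

lemma dehomogenize_simps:
  "dehomogenize (const3 c) = [:[:c:]:]" "dehomogenize varX = [:[:0, 1:]:]"
  "dehomogenize varY = 1" "dehomogenize varZ = [:0, 1:]"
  by (simp_all add: dehomogenize_def const3_def varX_def varY_def varZ_def
    poly_hom.map_poly_pCons_hom one_pCons)

lemma homogenize_simps:
  "homogenize (const3 c) = const3 c" "homogenize varX = varX * varZ"
  "homogenize varY = varZ" "homogenize varZ = varY * varZ"
  unfolding homogenize_def by (simp_all only: eval3_simps [OF comm_ring_hom_const3])

text \<open>Over the fraction field, substituting X/Y, Z/Y and Y for x, z and y gives a left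
  inverse.\<close>

lemma homogenize_eq_0_iff: "homogenize (F :: 'k::field poly poly poly) = 0 \<longleftrightarrow> F = 0"
proof
  interpret H: comm_ring_hom "homogenize :: 'k poly poly poly \<Rightarrow> _"
    by (rule comm_ring_hom_homogenize)
  interpret t: comm_ring_hom "to_fract :: 'k poly poly poly \<Rightarrow> _"
    by unfold_locales simp_all
  interpret c: comm_ring_hom "const3 :: 'k \<Rightarrow> _" by (rule comm_ring_hom_const3)
  define h :: "'k \<Rightarrow> 'k poly poly poly fract" where "h c = to_fract (const3 c)" for c
  have h: "comm_ring_hom h"
    by unfold_locales (simp_all add: h_def c.hom_add c.hom_mult)
  let ?Y = "to_fract varY :: 'k poly poly poly fract"
  define \<psi> where "\<psi> = eval3 h (to_fract varX / ?Y) (to_fract varZ / ?Y) ?Y"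
  interpret \<psi>: comm_ring_hom \<psi>
    unfolding \<psi>_def by (rule comm_ring_hom_eval3 [OF h])
  have Y: "?Y \<noteq> 0" by (simp add: varY_def)
  have "(\<psi> \<circ> homogenize) G = to_fract G" for G
  proof (rule hom3_eqI)
    show "comm_ring_hom (\<psi> \<circ> homogenize)"
      by unfold_locales (simp_all add: H.hom_add H.hom_mult \<psi>.hom_add \<psi>.hom_mult)
    show "comm_ring_hom (to_fract :: 'k poly poly poly \<Rightarrow> _)"
      by (rule t.comm_ring_hom_axioms)
  qed (use Y in \<open>simp_all add: homogenize_simps \<psi>.hom_mult,
      simp_all add: \<psi>_def eval3_simps [OF h] h_def\<close>)
  then have "\<psi> (homogenize F) = to_fract F" by simp
  then show "F = 0" if "homogenize F = 0" using that by simp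
  show "homogenize F = 0" if "F = 0" using that by simp
qed

lemma homogenize_at_1:
  fixes F :: "'k::field poly poly poly"
  shows "poly (homogenize F) 1 = dehomogenize F"
proof -
  interpret H: comm_ring_hom "homogenize :: 'k poly poly poly \<Rightarrow> _"
    by (rule comm_ring_hom_homogenize)
  have "((\<lambda>p. poly p 1) \<circ> homogenize) F = dehomogenize F"
  proof (rule hom3_eqI)
    show "comm_ring_hom ((\<lambda>p. poly p 1) \<circ> (homogenize :: 'k poly poly poly \<Rightarrow> _))"
      by unfold_locales (simp_all add: H.hom_add H.hom_mult)
  qed (simp_all add: comm_ring_hom_dehomogenize dehomogenize_simps homogenize_simps,
      simp_all add: varX_def varY_def varZ_def const3_def)
  then show ?thesis by simp
qed

section \<open>Homogeneity and irreducibility of T\<close>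

context exponents
begin

abbreviation (input) T where "T \<equiv> T_poly A B :: 'k poly poly poly"

lemma T_mult: "T * vandermonde (varX ^ d) (varY ^ d) (varZ ^ d) = gen_vandermonde A B varX varY varZ"
  unfolding d_def by (rule T_poly_mult_vandermonde)

text \<open>At Y = 0, R becomes X^B Z^A - X^A Z^B, which is not zero. This excludes the factors Y^m,
  which putting Y = 1 would hide.\<close>

lemma T_not_dvd_by_varY: "\<not> varY dvd T"
proof
  assume "varY dvd T"
  then obtain U where U: "T = varY * U" ..
  let ?h = "map_poly (\<lambda>q. poly q 0) :: 'k poly poly poly \<Rightarrow> 'k poly poly"
  interpret h: comm_ring_hom ?h by (rule comm_ring_hom_map_poly_eval)
  have vars: "?h varX = [:[:0, 1:]:]" "?h varY = 0" "?h varZ = [:0, 1:]"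
    by (simp_all add: varX_def varY_def varZ_def poly_hom.map_poly_pCons_hom)
  have "?h T = 0" by (simp only: U h.hom_mult vars mult_zero_left)
  then have "?h (gen_vandermonde A B varX varY varZ) = 0"
    unfolding T_mult [symmetric] h.hom_mult by simp
  then have "gen_vandermonde A B [:[:0, 1:]:] 0 [:0, 1:] = (0 :: 'k poly poly)"
    unfolding hom_gen_vandermonde [OF h.comm_ring_hom_axioms] vars .
  then have "mono2 B A - mono2 A B = (0 :: 'k poly poly)"
    using B_pos B_less_A by (simp add: gen_vandermonde_expand mono2_eq algebra_simps power_0_left)
  then have "coeff (mono2 B A - mono2 A B :: 'k poly poly) B = 0" by simp
  then show False using B_less_A by (simp add: mono2_def)
qed

lemma T_nonzero: "T \<noteq> 0"
  using T_not_dvd_by_varY by auto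

lemma plane_factorization_dehomogenize:
  assumes "T = F * G"
  shows "plane_factorization A B d (dehomogenize F) (dehomogenize G)"
proof unfold_locales
  interpret h: comm_ring_hom "dehomogenize :: 'k poly poly poly \<Rightarrow> _"
    by (rule comm_ring_hom_dehomogenize)
  show "dehomogenize F * dehomogenize G * vandermonde ([:[:0, 1:]:] ^ d) 1 ([:0, 1:] ^ d) =
      gen_vandermonde A B [:[:0, 1:]:] 1 [:0, 1:]"
    using arg_cong [OF T_mult, of dehomogenize]
    by (simp add: assms h.hom_mult hom_vandermonde [OF comm_ring_hom_dehomogenize]
      hom_gen_vandermonde [OF comm_ring_hom_dehomogenize] h.hom_power dehomogenize_simps)
qed

lemma plane_gen_vandermonde_nonzero:
  "gen_vandermonde A B [:[:0, 1:]:] 1 [:0, 1:] \<noteq> (0 :: 'k poly poly)"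
proof
  assume "gen_vandermonde A B [:[:0, 1:]:] 1 [:0, 1:] = (0 :: 'k poly poly)"
  then have "mono2 B A - mono2 0 A + mono2 0 B - mono2 A B + mono2 A 0 - mono2 B 0 =
      (0 :: 'k poly poly)"
    by (simp add: gen_vandermonde_expand mono2_eq algebra_simps)
  then have "coeff (coeff (mono2 B A - mono2 0 A + mono2 0 B - mono2 A B + mono2 A 0 - mono2 B 0)
      A) B = (0 :: 'k)"
    by simp
  then show False using B_pos B_less_A by (simp add: mono2_def)
qed

text \<open>R is homogeneous of degree A + B and V(X^d, Y^d, Z^d) of degree 3d; cancelling V leaves
  a single power of the grading variable.\<close>

lemma homogenize_T:
  "homogenize T = monom (dehomogenize T) (A + B - 3 * d)"
proof -
  interpret H: comm_ring_hom "homogenize :: 'k poly poly poly \<Rightarrow> _"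
    by (rule comm_ring_hom_homogenize)
  interpret pf: plane_factorization A B d K "dehomogenize T" "dehomogenize 1"
    by (rule plane_factorization_dehomogenize) simp
  \<comment> \<open>In the target ring k[x][z][y], \<open>varZ\<close> is the grading variable y and
    \<open>varY\<close> is z.\<close>
  let ?x = "varX :: 'k poly poly poly" and ?y = "varZ :: 'k poly poly poly"
    and ?z = "varY :: 'k poly poly poly"
  have one: "dehomogenize 1 = (1 :: 'k poly poly)"
    using comm_ring_hom.axioms comm_ring_hom_dehomogenize
    by (metis dehomogenize_def map_poly_1' poly_1)
  have const: "comm_ring_hom (\<lambda>a :: 'k poly poly. [:a:])"
    by unfold_locales (simp_all add: one_pCons)
  have xz: "?x = [:[:[:0, 1:]:]:]" "?z = [:[:0, 1:]:]"
    by (simp_all add: varX_def varY_def)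
  let ?V = "vandermonde ([:[:0, 1:]:] ^ d) 1 ([:0, 1:] ^ d) :: 'k poly poly"
  let ?R = "gen_vandermonde A B [:[:0, 1:]:] 1 [:0, 1:] :: 'k poly poly"
  have "[:?R:] = gen_vandermonde A B ?x 1 ?z"
    by (simp only: hom_gen_vandermonde [OF const] xz pCons_one)
  then have R: "gen_vandermonde A B (?x * ?y) ?y (?z * ?y) = [:?R:] * ?y ^ (A + B)"
    using gen_vandermonde_scale [of A B ?x ?y 1 ?z] by (simp only: mult_1_left)
  have "[:?V:] = vandermonde (?x ^ d) 1 (?z ^ d)"
    by (simp only: hom_vandermonde [OF const] poly_const_pow [symmetric] xz pCons_one)
  then have V: "vandermonde ((?x * ?y) ^ d) (?y ^ d) ((?z * ?y) ^ d) = [:?V:] * ?y ^ (3 * d)"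
    using vandermonde_scale [of "?x ^ d" "?y ^ d" 1 "?z ^ d"]
    by (simp only: mult_1_left power_mult_distrib power_mult [symmetric] mult.commute [of d])
  have "homogenize T * ([:?V:] * ?y ^ (3 * d)) = [:?R:] * ?y ^ (A + B)"
    using arg_cong [OF T_mult, of homogenize]
    by (simp only: H.hom_mult hom_vandermonde [OF comm_ring_hom_homogenize]
      hom_gen_vandermonde [OF comm_ring_hom_homogenize] H.hom_power R V homogenize_simps)
  also have "?R = dehomogenize T * ?V"
    using pf.fac by (simp add: one)
  also have "[:dehomogenize T * ?V:] = [:dehomogenize T:] * [:?V:]" by simp
  \<comment> \<open>The subtraction is not truncated, since A > 2d and B \<ge> d.\<close>
  also have "A + B = (A + B - 3 * d) + 3 * d"
    using pf.A_ge d_dvd_B B_pos dvd_imp_le [of d B] by linarith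
  finally have "([:?V:] * ?y ^ (3 * d)) * homogenize T =
      ([:?V:] * ?y ^ (3 * d)) * ([:dehomogenize T:] * ?y ^ (A + B - 3 * d))"
    by (simp only: power_add ac_simps)
  moreover have "?V \<noteq> 0"
    using pf.fac plane_gen_vandermonde_nonzero by auto
  then have "[:?V:] * ?y ^ (3 * d) \<noteq> 0"
    by (simp add: varZ_def)
  ultimately have "homogenize T = [:dehomogenize T:] * ?y ^ (A + B - 3 * d)"
    by (simp only: mult_cancel_left) simp
  then show ?thesis by (simp add: varZ_def monom_altdef)
qed

text \<open>A factor of T is homogeneous, so it is determined by its restriction to Y = 1 up to a
  power of Y; and Y does not divide T.\<close>

lemma factor_of_T_const:
  assumes FG: "T = F * G" and c: "dehomogenize F = [:[:c:]:]" "c \<noteq> 0"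
  shows "F dvd 1"
proof -
  interpret H: comm_ring_hom "homogenize :: 'k poly poly poly \<Rightarrow> _"
    by (rule comm_ring_hom_homogenize)
  have "homogenize F * homogenize G = monom (dehomogenize T) (A + B - 3 * d)"
    unfolding homogenize_T [symmetric] by (simp add: FG H.hom_mult)
  moreover have "dehomogenize T \<noteq> 0"
  proof
    assume "dehomogenize T = 0"
    then have "homogenize T = 0" by (simp add: homogenize_T)
    then show False using T_nonzero by (simp add: homogenize_eq_0_iff)
  qed
  ultimately obtain b m where m: "homogenize F = monom b m"
    using factor_of_monom by blast
  have "b = [:[:c:]:]"
    using homogenize_at_1 [of F] c by (simp add: m poly_monom)
  then have "homogenize F = homogenize (const3 c * varY ^ m)"
    unfolding m H.hom_mult H.hom_power homogenize_simps
    by (simp add: const3_def varZ_def monom_altdef)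
  then have "homogenize (F - const3 c * varY ^ m) = 0" by (simp add: H.hom_minus)
  then have F: "F = const3 c * varY ^ m" by (simp add: homogenize_eq_0_iff)
  have "m = 0"
  proof (rule ccontr)
    assume "m \<noteq> 0"
    then have "varY dvd F" unfolding F by (intro dvd_mult dvd_power) simp
    then show False using T_not_dvd_by_varY FG by (metis dvd_mult2)
  qed
  then have "F * const3 (inverse c) = 1"
    using c(2) by (simp add: F const3_def one_pCons)
  then show ?thesis by (metis dvd_triv_left)
qed

lemma irreducible_T: "irreducible T"
proof (rule irreducibleI)
  show "T \<noteq> 0" by (rule T_nonzero)
  show "\<not> T dvd 1"
  proof
    assume "T dvd 1"
    then obtain U where "1 = T * U" ..
    interpret h: comm_ring_hom "dehomogenize :: 'k poly poly poly \<Rightarrow> _"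
      by (rule comm_ring_hom_dehomogenize)
    interpret pf: plane_factorization A B d K "dehomogenize T" "dehomogenize 1"
      by (rule plane_factorization_dehomogenize) simp
    have "dehomogenize T * dehomogenize U = 1"
      using arg_cong [OF \<open>1 = T * U\<close>, of dehomogenize] by (simp add: h.hom_mult)
    then have "dehomogenize T dvd 1" by (metis dvd_triv_left)
    then have "degree (dehomogenize T) = 0"
      by (metis degree_1 dvd_imp_degree_le le_zero_eq zero_neq_one)
    then show False using pf.degree_and_lead_coeff(1) pf.A_ge by simp
  qed
  show "F dvd 1 \<or> G dvd 1" if FG: "T = F * G" for F G
  proof -
    interpret pf: plane_factorization A B d K "dehomogenize F" "dehomogenize G"
      by (rule plane_factorization_dehomogenize) fact
    have "T = G * F" using FG by (simp add: mult.commute)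
    then show ?thesis
      using pf.f_or_g_const factor_of_T_const [OF FG] factor_of_T_const [of G F] by blast
  qed
qed

end

theorem mainTheorem2:
  fixes p A B :: nat
  assumes "prime p"
    and "is_algebraic_closure_of_F p TYPE('k::alg_closed_field)"
    and "A > B" and "B > 0"
    and "\<not> p dvd A" and "\<not> p dvd B" and "\<not> p dvd (A - B)"
    and "A \<noteq> 2 * B"
  shows "irreducible (T_poly A B :: 'k poly poly poly)"
proof -
  have "CHAR('k) = p" using assms(2) by (simp add: is_algebraic_closure_of_F_def)
  then have unit: "of_nat n \<noteq> (0 :: 'k)" if "\<not> p dvd n" for n
    using that by (simp add: of_nat_eq_0_iff_char_dvd)
  have "of_nat A \<noteq> (of_nat B :: 'k)"
    using unit [OF assms(7)] assms(3) by (simp add: of_nat_diff)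
  then interpret exponents A B "gcd A B" "TYPE('k)"
    by unfold_locales (use assms unit in auto)
  show ?thesis by (rule irreducible_T)
qed

end
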